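(* Let $f:\mathbb{R}^d\to\mathbb{R}$ be bounded from below by $f^*:=\min_{x\in\mathbb{R}^d}f(x)$ and differentiable with $L$-Lipschitz gradient, i.e. $\|\nabla f(x)-\nabla f(y)\|\le L\|x-y\|$ for all $x,y\in\mathbb{R}^d$. Suppose the stochastic gradients are unbiased and their noise is uniformly bounded by $\sigma_g\ge 0$ (as made precise in the context), let $q>\sigma_g$ with $q>0$, let $\beta\in[0,1)$, and let the step sizes $\{\alpha_t\}_{t\ge1}$ be positive and nonincreasing with $\alpha_t=\Theta(t^{-(1-\theta)})$ for some $\theta\in(0,1/2)$. Let $\{x_t\},\{y_t\}$ be the SNAG-CN (stochastic Nesterov accelerated gradient) iterates $$y_{t+1}=x_t-\alpha_t g_t^{CN},\qquad x_{t+1}=y_{t+1}+\beta(y_{t+1}-y_t),\quad t\ge1,$$ and set $v_t:=\beta(y_t-y_{t-1})$ and $z_t:=x_t+\frac{\beta}{1-\beta}v_t$. Then, with $\Psi_q(r):=\min\{r^2,qr\}$, almost surely $$\sum_{t=1}^{\infty}\alpha_t\Psi_q(\|\nabla f(x_t)\|)<\infty,\qquad \sum_{t=1}^{\infty}\|v_t\|^2<\infty.$$ In particular, $\|v_t\|\to0$ and $\|z_t-x_t\|\to0$ a.s. Moreover, $$\min_{1\le i\le t}\Psi_q(\|\nabla f(x_i)\|)=o(t^{-\theta})\quad\text{a.s.},$$ and thus $$\min_{1\le i\le t}\|\nabla f(x_i)\|=o(t^{-\theta/2})\quad\text{a.s.}$$ If, in addition, $f$ is $\mu$-strongly convex for some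 $\mu>0$, i.e. $f(y)\ge f(x)+\langle\nabla f(x),y-x\rangle+\frac{\mu}{2}\|y-x\|^2$ for all $x,y\in\mathbb{R}^d$, then $$\min_{1\le i\le t}\big(f(x_i)-f^*\big)=o(t^{-\theta})\quad\text{a.s.}$$
   Context: $\|\cdot\|$ is the Euclidean norm on $\mathbb{R}^d$. Stochastic gradient oracle: $\nabla f(x;\xi)$ denotes a (measurable) stochastic gradient at $x$ with random sample $\xi$; at step $t$ a random sample $\xi_t$ is drawn. Clipping: for $q>0$ and $v\in\mathbb{R}^d$, $\mathrm{clip}_q(v):=\min(1,q/\|v\|)\,v$ (with $\mathrm{clip}_q(0)=0$). Clipped noisy stochastic gradient: $g_t^{CN}:=\mathrm{clip}_q(\nabla f(x_t;\xi_t))+q\zeta_t$, where $\zeta_t\sim\mathcal{N}(0,\sigma_{CN}^2 I)$ is zero-mean Gaussian noise in $\mathbb{R}^d$ with variance parameter $\sigma_{CN}^2$, independent of the past and of $\xi_t$. Filtration: $\mathcal{F}_t$ is the natural filtration, i.e. the $\sigma$-algebra generated by the initialization and $\xi_1,\dots,\xi_{t-1},\zeta_1,\dots,\zeta_{t-1}$. Initialization: $y_0,y_1$ are $\mathcal{F}_1$-measurable and $x_1=y_1+\beta(y_1-y_0)$; hence $x_t,y_t$ are $\mathcal{F}_t$-measurable. Unbiasedness: $\mathbb{E}[\nabla f(x_t;\xi_t)\mid\mathcal{F}_t]=\nabla f(x_t)$ for all $t$. Uniformly bounded noise: $\|\nabla f(x;\xi)-\nabla f(x)\|\le\sigma_g$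 almost surely for every $x\in\mathbb{R}^d$; in particular $\|\nabla f(x_t;\xi_t)-\nabla f(x_t)\|\le\sigma_g$ a.s. for every $t$. Asymptotic notation $\Theta(\cdot)$, $o(\cdot)$ is as $t\to\infty$; "$o(\cdot)$ a.s." means that the $o(\cdot)$ relation holds along almost every sample path. Step sizes are deterministic. *)

theory Defs
  imports "HOL-Probability.Probability" "HOL-Library.Landau_Symbols"
begin

definition clip :: "real \<Rightarrow> 'a::euclidean_space \<Rightarrow> 'a" where
  "clip q v = min 1 (q / norm v) *\<^sub>R v"

definition Psi :: "real \<Rightarrow> real \<Rightarrow> real" where
  "Psi q r = min (r\<^sup>2) (q * r)"

text \<open>
  The law of \<open>s\<close> times a standard Gaussian vector, i.e. the normal distribution with mean \<open>0\<close> and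
  covariance \<open>s\<^sup>2\<close> times the identity. Scaling the standard law, rather than using a density with
  standard deviation \<open>s\<close>, also covers \<open>s = 0\<close>, where the law is the Dirac measure at \<open>0\<close>.
\<close>
definition isotropic_gaussian :: "real \<Rightarrow> 'a::euclidean_space measure" where
  "isotropic_gaussian s =
     distr (density lborel (\<lambda>x. ennreal (\<Prod>b\<in>Basis. std_normal_density (x \<bullet> b)))) borel (\<lambda>x. s *\<^sub>R x)"

definition natural_filtration ::
  "'w measure \<Rightarrow> ('w \<Rightarrow> 'i) \<Rightarrow> 'i measure \<Rightarrow> (nat \<Rightarrow> 'w \<Rightarrow> 's) \<Rightarrow> 's measure \<Rightarrow>
   (nat \<Rightarrow> 'w \<Rightarrow> 'a::euclidean_space) \<Rightarrow> nat \<Rightarrow> 'w measure" where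
  "natural_filtration M ini I \<xi> S \<zeta> t =
     sigma (space M)
       (sets (vimage_algebra (space M) ini I)
        \<union> (\<Union>s\<in>{1..<t}. sets (vimage_algebra (space M) (\<xi> s) S))
        \<union> (\<Union>s\<in>{1..<t}. sets (vimage_algebra (space M) (\<zeta> s) borel)))"

text \<open>
  Coordinatewise conditional expectation. Since \<open>real_cond_exp\<close> is the difference of the conditional
  expectations of the positive and negative parts, it is meaningful as soon as the absolute value
  has an almost surely finite conditional expectation; integrability is not needed.
\<close>
definition vec_cond_exp ::
  "'w measure \<Rightarrow> 'w measure \<Rightarrow> ('w \<Rightarrow> 'a::euclidean_space) \<Rightarrow> 'w \<Rightarrow> 'a" where
  "vec_cond_exp M F X \<omega> = (\<Sum>b\<in>Basis. real_cond_exp M F (\<lambda>\<omega>'. X \<omega>' \<bullet> b) \<omega> *\<^sub>R b)"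

text \<open>\<open>Z\<close> is independent of the \<open>\<sigma>\<close>-algebra generated jointly by \<open>F\<close> and the random element \<open>X\<close>.\<close>
definition indep_of_past_and ::
  "'w measure \<Rightarrow> 'w measure \<Rightarrow> ('w \<Rightarrow> 's) \<Rightarrow> 's measure \<Rightarrow> ('w \<Rightarrow> 'a::euclidean_space) \<Rightarrow> bool" where
  "indep_of_past_and M F X S Z \<longleftrightarrow>
     prob_space.indep_set M
       (sets (sigma (space M) (sets F \<union> sets (vimage_algebra (space M) X S))))
       (sets (vimage_algebra (space M) Z borel))"

definition strongly_convex :: "real \<Rightarrow> ('a::euclidean_space \<Rightarrow> real) \<Rightarrow> ('a \<Rightarrow> 'a) \<Rightarrow> bool" where
  "strongly_convex \<mu> f gradf \<longleftrightarrow>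
     (\<forall>u w. f w \<ge> f u + gradf u \<bullet> (w - u) + \<mu> / 2 * (norm (w - u))\<^sup>2)"

end

theory Submission
  imports Defs
begin

text \<open>
  The auxiliary point \<open>z t = x t + \<beta> / (1 - \<beta>) * v t\<close> absorbs the momentum: it moves by
  \<open>- \<alpha> t / (1 - \<beta>)\<close> times the clipped noisy gradient. In the descent inequality for \<open>f (z t)\<close> the
  clipped gradient contributes at least a constant multiple of \<open>\<alpha> t * Psi q (norm (gradf (x t)))\<close>
  plus terms linear in the two noises, and the errors are bounded by \<open>(norm (v t))\<^sup>2\<close> and
  \<open>(\<alpha> t)\<^sup>2 * (norm (gCN t))\<^sup>2\<close>. The second error is summable in expectation, because the clipped
  noisy gradients have uniformly bounded second moments, and since \<open>v\<close> contracts by \<open>\<beta>\<close> up to the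
  same term, so is the first. No supermartingale convergence theorem is needed: on the events of
  the initial \<open>\<sigma>\<close>-algebra on which \<open>y 0\<close> and \<open>y 1\<close> are bounded, the noise terms are integrable with mean
  zero, so taking expectations and telescoping bounds the expected weighted sum of \<open>Psi\<close>. The rates
  follow because the steps with index between \<open>t / 2\<close> and \<open>t\<close> have total length of order \<open>t powr \<theta>\<close>.
\<close>

section \<open>Deterministic estimates\<close>

lemma descent_lemma:
  fixes f :: "'a::real_inner \<Rightarrow> real"
  assumes grad: "\<And>u. GDERIV f u :> g u"
    and lipschitz: "\<And>u w. norm (g u - g w) \<le> L * norm (u - w)"
  shows "f w \<le> f u + g u \<bullet> (w - u) + L / 2 * (norm (w - u))\<^sup>2"
proof -
  define d where "d = w - u"
  \<comment> \<open>\<open>\<phi>\<close> follows \<open>f\<close> along the segment from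
    \<open>u\<close> to \<open>w\<close> and subtracts the linear and quadratic parts of the bound,
    so the claim becomes \<open>\<phi> 1 \<le> \<phi> 0\<close>; the Lipschitz condition makes the
    derivative nonpositive.\<close>
  define \<phi> where "\<phi> s = f (u + s *\<^sub>R d) - s * (g u \<bullet> d) - L / 2 * s\<^sup>2 * (norm d)\<^sup>2" for s :: real
  have line: "((\<lambda>s. f (u + s *\<^sub>R d)) has_real_derivative g (u + s *\<^sub>R d) \<bullet> d) (at s)" for s
  proof -
    have "((\<lambda>s. u + s *\<^sub>R d) has_derivative (\<lambda>h. h *\<^sub>R d)) (at s)"
      by (auto intro!: derivative_eq_intros)
    from diff_chain_at[OF this grad[of "u + s *\<^sub>R d", unfolded gderiv_def]]
    have "((\<lambda>s. f (u + s *\<^sub>R d)) has_derivative (\<lambda>h. (h *\<^sub>R d) \<bullet> g (u + s *\<^sub>R d))) (at s)"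
      by (simp add: o_def)
    then show ?thesis
      unfolding has_field_derivative_def
      by (rule has_derivative_eq_rhs) (auto simp: inner_commute mult.commute)
  qed
  have "\<phi> 1 \<le> \<phi> 0"
  proof (rule DERIV_nonpos_imp_nonincreasing[of 0 1 \<phi>])
    fix s :: real assume s: "0 \<le> s" "s \<le> 1"
    have "(\<phi> has_real_derivative g (u + s *\<^sub>R d) \<bullet> d - g u \<bullet> d - L * s * (norm d)\<^sup>2) (at s)"
      unfolding \<phi>_def by (auto intro!: derivative_eq_intros line)
    moreover have "g (u + s *\<^sub>R d) \<bullet> d - g u \<bullet> d \<le> L * s * (norm d)\<^sup>2"
    proof -
      have "g (u + s *\<^sub>R d) \<bullet> d - g u \<bullet> d \<le> norm (g (u + s *\<^sub>R d) - g u) * norm d"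
        by (metis inner_diff_left norm_cauchy_schwarz)
      also have "\<dots> \<le> (L * norm (s *\<^sub>R d)) * norm d"
        using lipschitz[of "u + s *\<^sub>R d" u] by (intro mult_right_mono) auto
      finally show ?thesis using s by (simp add: power2_eq_square mult.assoc)
    qed
    ultimately show "\<exists>y. (\<phi> has_real_derivative y) (at s) \<and> y \<le> 0" by force
  qed simp
  then show ?thesis by (simp add: \<phi>_def d_def)
qed

lemma norm_clip_le: "0 \<le> q \<Longrightarrow> norm (clip q v) \<le> q"
  by (cases "v = 0") (auto simp: clip_def min_def field_simps)

lemma Psi_nonneg: "0 \<le> q \<Longrightarrow> 0 \<le> r \<Longrightarrow> 0 \<le> Psi q r"
  by (simp add: Psi_def)

lemma Psi_mono: "0 \<le> q \<Longrightarrow> 0 \<le> r \<Longrightarrow> r \<le> r' \<Longrightarrow> Psi q r \<le> Psi q r'"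
  unfolding Psi_def by (intro min.mono power_mono mult_left_mono)

text \<open>
  Clipping only displaces a vector of norm at most \<open>norm g + \<sigma>\<close>, and by at most
  \<open>max 0 (norm g + \<sigma> - q)\<close>, which is less than \<open>norm g\<close> because \<open>\<sigma> < q\<close>; what remains of
  \<open>norm g\<close> is \<open>min (norm g) (q - \<sigma>)\<close>.
\<close>
lemma inner_clip_ge:
  assumes noise: "norm (u - g) \<le> \<sigma>" and \<sigma>: "\<sigma> < q" and q: "0 < q"
  shows "(q - \<sigma>) / q * Psi q (norm g) + g \<bullet> (u - g) \<le> g \<bullet> clip q u"
proof -
  define m where "m = max 0 (norm g + \<sigma> - q)"
  have \<sigma>0: "0 \<le> \<sigma>" using noise norm_ge_zero order_trans by blast
  have displacement: "norm (u - clip q u) \<le> m"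
  proof (cases "norm u \<le> q")
    case True
    \<comment> \<open>At \<open>u = 0\<close> the quotient \<open>q / norm u\<close> is 0 by
      convention, so the scaling factor is 0 instead of 1; the clipped vector is \<open>u\<close>
      all the same.\<close>
    then have "clip q u = u" using q by (cases "u = 0") (auto simp: clip_def min_def field_simps)
    then show ?thesis by (simp add: m_def)
  next
    case False
    then have "0 < norm u" using q by linarith
    have "u - clip q u = (1 - q / norm u) *\<^sub>R u"
      using False q \<open>0 < norm u\<close> by (auto simp: clip_def min_def scaleR_left_diff_distrib)
    then have "norm (u - clip q u) = (1 - q / norm u) * norm u"
      using False \<open>0 < norm u\<close> by simp
    also have "\<dots> = norm u - q" using \<open>0 < norm u\<close> by (simp add: field_simps)
    also have "\<dots> \<le> norm g + \<sigma> - q" using norm_triangle_sub[of u g] noise by linarith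
    finally show ?thesis by (simp add: m_def)
  qed
  have "g \<bullet> u - g \<bullet> clip q u \<le> norm g * norm (u - clip q u)"
    by (metis inner_diff_right norm_cauchy_schwarz)
  also have "\<dots> \<le> norm g * m" by (intro mult_left_mono displacement) auto
  finally have *: "g \<bullet> u - norm g * m \<le> g \<bullet> clip q u" by linarith
  \<comment> \<open>If \<open>m = 0\<close>, the factor \<open>(q - \<sigma>) / q\<close> is at most
    1 and the quadratic branch of \<open>Psi\<close> suffices. Otherwise
    \<open>norm g - m = q - \<sigma>\<close>, and the linear branch, scaled by this factor, matches
    \<open>norm g * (q - \<sigma>)\<close>.\<close>
  have "(q - \<sigma>) / q * Psi q (norm g) \<le> (norm g)\<^sup>2 - norm g * m"
  proof (cases "norm g + \<sigma> \<le> q")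
    case True
    have "(q - \<sigma>) / q * Psi q (norm g) \<le> 1 * (norm g)\<^sup>2"
      using \<sigma> q \<sigma>0 by (intro mult_mono) (auto simp: Psi_def)
    then show ?thesis using True by (simp add: m_def)
  next
    case False
    have "(q - \<sigma>) / q * Psi q (norm g) \<le> (q - \<sigma>) / q * (q * norm g)"
      using \<sigma> q by (intro mult_left_mono) (auto simp: Psi_def)
    also have "\<dots> = (q - \<sigma>) * norm g" using q by simp
    also have "\<dots> = (norm g)\<^sup>2 - norm g * m"
      using False q by (simp add: m_def power2_eq_square algebra_simps)
    finally show ?thesis .
  qed
  with * show ?thesis by (simp add: inner_diff_right power2_norm_eq_inner)
qed

section \<open>Summability from one-step recursions\<close>

lemma summable_decrease:
  fixes \<Phi> s e :: "nat \<Rightarrow> real"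
  assumes step: "\<And>t. \<Phi> (Suc t) + s t \<le> \<Phi> t + e t"
    and \<Phi>: "\<And>t. 0 \<le> \<Phi> t" and s: "\<And>t. 0 \<le> s t" and e: "\<And>t. 0 \<le> e t" "summable e"
  shows "summable s"
proof (rule summableI_nonneg_bounded)
  fix n
  \<comment> \<open>Telescoping: the total decrease is paid for by the initial energy and the
    accumulated errors. The final energy stays on the left and is dropped by nonnegativity.\<close>
  have "\<Phi> n + sum s {..<n} \<le> \<Phi> 0 + sum e {..<n}"
  proof (induction n)
    case (Suc n)
    then show ?case using step[of n] by simp
  qed simp
  moreover have "sum e {..<n} \<le> suminf e" using e by (intro sum_le_suminf) auto
  ultimately show "sum s {..<n} \<le> \<Phi> 0 + suminf e" using \<Phi>[of n] by linarith
qed (fact s)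

text \<open>The contraction loses \<open>(1 - \<beta>) * a t\<close> in each step, so
  \<open>a\<close> is at once the energy and, up to that factor, its own decrease.\<close>

lemma summable_contraction:
  fixes a e :: "nat \<Rightarrow> real"
  assumes step: "\<And>t. a (Suc t) \<le> \<beta> * a t + e t" and \<beta>: "\<beta> < 1"
    and a: "\<And>t. 0 \<le> a t" and e: "\<And>t. 0 \<le> e t" "summable e"
  shows "summable a"
proof -
  have "summable (\<lambda>t. (1 - \<beta>) * a t)"
  proof (rule summable_decrease[of a _ e])
    show "a (Suc t) + (1 - \<beta>) * a t \<le> a t + e t" for t
      using step[of t] by (simp add: algebra_simps)
  qed (use a e \<beta> in auto)
  then show ?thesis using \<beta> by (simp add: summable_cmult_iff)
qed

section \<open>Polynomial step sizes and rates for running minima\<close>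

lemma powr_order_lower_bound:
  assumes pos: "\<And>t. 1 \<le> t \<Longrightarrow> 0 < \<alpha> t"
    and order: "\<alpha> \<in> \<Theta>(\<lambda>t. real t powr p)"
  obtains c where "0 < c" "eventually (\<lambda>t. c * real t powr p \<le> \<alpha> t) sequentially"
proof -
  from order have "\<alpha> \<in> \<Omega>(\<lambda>t. real t powr p)" by auto
  then obtain c where c: "0 < c" "eventually (\<lambda>t. c * norm (real t powr p) \<le> norm (\<alpha> t)) sequentially"
    by (rule landau_omega.bigE)
  from c(2) eventually_ge_at_top[of 1] have "eventually (\<lambda>t. c * real t powr p \<le> \<alpha> t) sequentially"
    by eventually_elim (use pos in force)
  with c(1) that show thesis by blast
qed

text \<open>Squaring doubles the exponent, and \<open>2 * p < -1\<close> is the convergence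
  condition for the p-series. For \<open>p = - (1 - \<theta>)\<close> this reads
  \<open>\<theta> < 1/2\<close>.\<close>

lemma powr_order_square_summable:
  assumes "\<alpha> \<in> O(\<lambda>t. real t powr p)" "p < -1/2"
  shows "summable (\<lambda>t. (\<alpha> t)\<^sup>2)"
proof (rule summable_comparison_test_bigo)
  show "summable (\<lambda>t. norm (real t powr (2 * p)))"
    using assms(2) by (simp add: summable_real_powr_iff)
  have "(\<lambda>t. (\<alpha> t)\<^sup>2) \<in> O(\<lambda>t. (real t powr p)\<^sup>2)"
    by (intro landau_o.big_power assms)
  also have "(\<lambda>t. (real t powr p)\<^sup>2) = (\<lambda>t. real t powr (2 * p))"
    by (simp add: power2_eq_square powr_add[symmetric])
  finally show "(\<lambda>t. (\<alpha> t)\<^sup>2) \<in> O(\<lambda>t. real t powr (2 * p))" .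
qed

text \<open>
  The steps with index in \<open>{t div 2<..t}\<close> alone have total length of order \<open>t powr \<theta>\<close>, while the
  weighted sum of \<open>a\<close> over that block is a Cauchy difference and tends to zero.
\<close>
lemma running_min_tendsto:
  fixes \<alpha> a m :: "nat \<Rightarrow> real"
  assumes pos: "\<And>t. 1 \<le> t \<Longrightarrow> 0 < \<alpha> t"
    and noninc: "\<And>t. 1 \<le> t \<Longrightarrow> \<alpha> (Suc t) \<le> \<alpha> t"
    and order: "\<alpha> \<in> \<Theta>(\<lambda>t. real t powr (- (1 - \<theta>)))"
    and a: "summable (\<lambda>t. \<alpha> (Suc t) * a (Suc t))"
    and m: "\<And>t i. 1 \<le> i \<Longrightarrow> i \<le> t \<Longrightarrow> m t \<le> a i" "\<And>t. 0 \<le> m t"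
  shows "(\<lambda>t. m t * real t powr \<theta>) \<longlonglongrightarrow> 0"
proof -
  obtain c where c: "0 < c"
    and ev: "eventually (\<lambda>t. c * real t powr (- (1 - \<theta>)) \<le> \<alpha> t) sequentially"
    using powr_order_lower_bound[OF pos order] by blast
  \<comment> \<open>The shift makes \<open>T n\<close> collect the indices from 1 to
    \<open>n\<close>, so \<open>T t - T (t div 2)\<close> is exactly the block.\<close>
  define T where "T n = (\<Sum>i<n. \<alpha> (Suc i) * a (Suc i))" for n
  have T: "T \<longlonglongrightarrow> suminf (\<lambda>t. \<alpha> (Suc t) * a (Suc t))"
    using a unfolding T_def by (rule summable_LIMSEQ)
  have half: "filterlim (\<lambda>t::nat. t div 2) sequentially sequentially"
    by (rule filterlim_at_top_div_const_nat) simp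
  \<comment> \<open>The factor \<open>2 / c\<close> arises because the block has at least
    \<open>t / 2\<close> terms, each with step size at least \<open>\<alpha> t\<close>, hence
    eventually at least \<open>c * real t powr (- (1 - \<theta>))\<close>.\<close>
  have block: "(\<lambda>t. 2 / c * (T t - T (t div 2))) \<longlonglongrightarrow> 0"
    using tendsto_mult_left[OF tendsto_diff[OF T filterlim_compose[OF T half]], of "2 / c"] by simp
  have up: "eventually (\<lambda>t. m t * real t powr \<theta> \<le> 2 / c * (T t - T (t div 2))) sequentially"
    using ev eventually_ge_at_top[of 1]
  proof eventually_elim
    case (elim t)
    have \<alpha>_ge: "\<alpha> t \<le> \<alpha> i" if "1 \<le> i" "i \<le> t" for i
      using that(2)
    proof (induction rule: dec_induct)
      case (step n)
      then show ?case using noninc[of n] that(1) by linarith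
    qed simp
    have "m t * real t powr \<theta> * (c / 2) = (real t / 2) * (c * real t powr (- (1 - \<theta>))) * m t"
      using elim(2) by (simp add: powr_diff field_simps powr_minus)
    also have "\<dots> \<le> (real t / 2) * \<alpha> t * m t"
      using elim m(2) by (intro mult_right_mono mult_left_mono) auto
    also have "\<dots> \<le> real (t - t div 2) * \<alpha> t * m t"
      using m(2) pos[OF elim(2)] by (intro mult_right_mono) (auto simp: less_imp_le)
    also have "\<dots> = (\<Sum>i\<in>{t div 2..<t}. \<alpha> t * m t)" by simp
    also have "\<dots> \<le> (\<Sum>i\<in>{t div 2..<t}. \<alpha> (Suc i) * a (Suc i))"
      using m pos \<alpha>_ge by (intro sum_mono mult_mono) (auto simp: less_imp_le)
    also have "\<dots> = T t - T (t div 2)"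
      unfolding T_def by (subst sum_diff_nat_ivl[of 0, symmetric]) (auto simp: atLeast0LessThan)
    finally show ?case using c by (simp add: field_simps)
  qed
  have low: "eventually (\<lambda>t. 0 \<le> m t * real t powr \<theta>) sequentially" using m(2) by simp
  show ?thesis by (rule tendsto_sandwich[OF low up tendsto_const block])
qed

lemma smallo_powr_neg_iff:
  "m \<in> o(\<lambda>t. real t powr (- \<theta>)) \<longleftrightarrow> (\<lambda>t. m t * real t powr \<theta>) \<longlonglongrightarrow> 0"
  for m :: "nat \<Rightarrow> real"
proof -
  \<comment> \<open>This holds at \<open>t = 0\<close> too: the power is 0 there, and so is a
    quotient by it.\<close>
  have eq: "(\<lambda>t. m t / real t powr (- \<theta>)) = (\<lambda>t. m t * real t powr \<theta>)"
    by (simp add: powr_minus divide_inverse)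
  have nz: "eventually (\<lambda>t. real t powr (- \<theta>) \<noteq> 0) sequentially"
    using eventually_gt_at_top[of 0] by eventually_elim simp
  show ?thesis
    using smalloI_tendsto[OF _ nz, of m] smalloD_tendsto[of m _ "\<lambda>t. real t powr (- \<theta>)"] unfolding eq by blast
qed

text \<open>The Polyak-Lojasiewicz inequality, by completing the square: the quadratic lower bound
  at \<open>u\<close> is smallest where \<open>g u + \<mu> *\<^sub>R (w - u)\<close>
  vanishes.\<close>

lemma strongly_convex_gap_le:
  assumes sc: "strongly_convex \<mu> f g" and \<mu>: "0 < \<mu>"
  shows "f u - f w \<le> (norm (g u))\<^sup>2 / (2 * \<mu>)"
proof -
  have "0 \<le> (norm (g u + \<mu> *\<^sub>R (w - u)))\<^sup>2" by simp
  also have "\<dots> = (norm (g u))\<^sup>2 + 2 * \<mu> * (g u \<bullet> (w - u)) + \<mu>\<^sup>2 * (norm (w - u))\<^sup>2"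
    by (simp only: power2_norm_eq_inner) (simp add: inner_add inner_commute power2_eq_square algebra_simps)
  finally have "- (g u \<bullet> (w - u)) - \<mu> / 2 * (norm (w - u))\<^sup>2 \<le> (norm (g u))\<^sup>2 / (2 * \<mu>)"
    using \<mu> by (simp add: field_simps power2_eq_square)
  moreover have "f u + g u \<bullet> (w - u) + \<mu> / 2 * (norm (w - u))\<^sup>2 \<le> f w"
    using sc by (auto simp: strongly_convex_def)
  ultimately show ?thesis by linarith
qed

text \<open>The averaging argument is applied twice: to the running minimum of \<open>Psi\<close>,
  and to \<open>Psi\<close> of the running minimum of \<open>r\<close>, which is admissible because
  \<open>Psi\<close> is monotone. In the second case the argument of \<open>Psi\<close> eventually
  lies in the quadratic range, and a square root halves the exponent.\<close>

lemma running_min_rates: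
  fixes \<alpha> r :: "nat \<Rightarrow> real"
  assumes pos: "\<And>t. 1 \<le> t \<Longrightarrow> 0 < \<alpha> t"
    and noninc: "\<And>t. 1 \<le> t \<Longrightarrow> \<alpha> (Suc t) \<le> \<alpha> t"
    and order: "\<alpha> \<in> \<Theta>(\<lambda>t. real t powr (- (1 - \<theta>)))"
    and q: "0 < q" and \<theta>: "0 < \<theta>"
    and r: "\<And>t. 0 \<le> r t"
    and sum: "summable (\<lambda>t. \<alpha> (Suc t) * Psi q (r (Suc t)))"
  shows "(\<lambda>t. Min ((\<lambda>i. Psi q (r i)) ` {1..t})) \<in> o(\<lambda>t. real t powr (- \<theta>))" (is ?A)
    and "(\<lambda>t. Min (r ` {1..t})) \<in> o(\<lambda>t. real t powr (- (\<theta> / 2)))" (is ?B)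
proof -
  \<comment> \<open>\<open>Min\<close> of the empty set is unspecified, whereas
    \<open>running_min_tendsto\<close> asks for nonnegativity at every index; the value 0 at
    \<open>t = 0\<close> does not affect the asymptotics.\<close>
  define m where "m t = (if t = 0 then 0 else Min (r ` {1..t}))" for t
  define p where "p t = (if t = 0 then 0 else Min ((\<lambda>i. Psi q (r i)) ` {1..t}))" for t
  have m_le: "m t \<le> r i" if "1 \<le> i" "i \<le> t" for t i
    using that by (auto simp: m_def)
  have m_attained: "\<exists>i\<in>{1..t}. m t = r i" if "1 \<le> t" for t
  proof -
    have "Min (r ` {1..t}) \<in> r ` {1..t}" using that by (intro Min_in) auto
    then obtain i where "i \<in> {1..t}" "Min (r ` {1..t}) = r i" by blast
    then show ?thesis using that by (auto simp: m_def intro!: bexI[of _ i])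
  qed
  have m0: "0 \<le> m t" for t
    using m_attained[of t] r by (cases "t = 0") (auto simp: m_def Suc_le_eq)
  have p0: "0 \<le> p t" for t
    using r q by (auto simp: p_def intro!: Min.boundedI Psi_nonneg)
  have "(\<lambda>t. p t * real t powr \<theta>) \<longlonglongrightarrow> 0"
    by (rule running_min_tendsto[OF pos noninc order sum]) (use p0 in \<open>auto simp: p_def\<close>)
  then have "p \<in> o(\<lambda>t. real t powr (- \<theta>))" by (simp add: smallo_powr_neg_iff)
  then show ?A
    by (rule landau_o.small.in_cong[THEN iffD1, rotated])
       (rule eventually_mono[OF eventually_gt_at_top[of 0]], simp add: p_def)
  have \<Psi>m: "(\<lambda>t. Psi q (m t) * real t powr \<theta>) \<longlonglongrightarrow> 0"
    by (rule running_min_tendsto[OF pos noninc order sum])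
       (use m0 m_le q in \<open>auto intro!: Psi_mono Psi_nonneg\<close>)
  \<comment> \<open>\<open>Psi q q = q\<^sup>2\<close> is the value where the two branches meet.
    Since \<open>real t powr \<theta>\<close> is at least 1 for \<open>t \<ge> 1\<close>, staying
    below this value forces \<open>m t \<le> q\<close>.\<close>
  have "eventually (\<lambda>t. Psi q (m t) * real t powr \<theta> < q\<^sup>2) sequentially"
    using order_tendstoD(2)[OF \<Psi>m, of "q\<^sup>2"] q by simp
  with eventually_ge_at_top[of 1]
  have "eventually (\<lambda>t. Psi q (m t) * real t powr \<theta> = (m t)\<^sup>2 * real t powr \<theta>) sequentially"
  proof eventually_elim
    case (elim t)
    have "Psi q (m t) * 1 \<le> Psi q (m t) * real t powr \<theta>"
      using elim(1) \<theta> m0 q by (intro mult_left_mono ge_one_powr_ge_zero Psi_nonneg) auto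
    then have "Psi q (m t) < q\<^sup>2" using elim by simp
    have "m t \<le> q"
    proof (rule ccontr)
      assume "\<not> m t \<le> q"
      then have "Psi q q \<le> Psi q (m t)" using q by (intro Psi_mono) auto
      moreover have "Psi q q = q\<^sup>2" by (simp add: Psi_def power2_eq_square)
      ultimately show False using \<open>Psi q (m t) < q\<^sup>2\<close> by simp
    qed
    then have "(m t)\<^sup>2 \<le> q * m t" using m0 by (simp add: power2_eq_square mult_right_mono)
    then show ?case by (simp add: Psi_def)
  qed
  from Lim_transform_eventually[OF \<Psi>m this]
  have m2: "(\<lambda>t. (m t)\<^sup>2 * real t powr \<theta>) \<longlonglongrightarrow> 0" .
  from tendsto_real_sqrt[OF this] have "(\<lambda>t. m t * real t powr (\<theta> / 2)) \<longlonglongrightarrow> 0"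
    using m0 by (simp add: real_sqrt_mult powr_half_sqrt_powr)
  then have "m \<in> o(\<lambda>t. real t powr (- (\<theta> / 2)))" by (simp only: smallo_powr_neg_iff)
  then show ?B
    by (rule landau_o.small.in_cong[THEN iffD1, rotated])
       (rule eventually_mono[OF eventually_gt_at_top[of 0]], simp add: m_def)
qed

text \<open>At an index where \<open>r\<close> attains its running minimum, \<open>h\<close> is at
  most \<open>K\<close> times the square of that minimum, so the rate squares. This carries the
  gradient rate over to function values.\<close>

lemma running_min_quadratic:
  fixes r h :: "nat \<Rightarrow> real"
  assumes r: "(\<lambda>t. Min (r ` {1..t})) \<in> o(\<lambda>t. real t powr (- (\<theta> / 2)))"
    and h: "\<And>t. 0 \<le> h t" "\<And>t. h t \<le> K * (r t)\<^sup>2"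
  shows "(\<lambda>t. Min (h ` {1..t})) \<in> o(\<lambda>t. real t powr (- \<theta>))"
proof -
  define m where "m t = Min (r ` {1..t})" for t
  have "(\<lambda>t. m t * real t powr (\<theta> / 2)) \<longlonglongrightarrow> 0"
    using r unfolding m_def by (simp only: smallo_powr_neg_iff)
  from tendsto_mult[OF this this] have m2: "(\<lambda>t. (m t)\<^sup>2 * real t powr \<theta>) \<longlonglongrightarrow> 0"
    by (simp add: power2_eq_square mult.assoc mult.left_commute powr_add[symmetric])
  have up: "eventually (\<lambda>t. Min (h ` {1..t}) * real t powr \<theta> \<le> K * ((m t)\<^sup>2 * real t powr \<theta>)) sequentially"
    using eventually_ge_at_top[of 1]
  proof eventually_elim
    case (elim t)
    have "m t \<in> r ` {1..t}" unfolding m_def using elim by (intro Min_in) auto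
    then obtain i where "i \<in> {1..t}" "m t = r i" by blast
    then have "Min (h ` {1..t}) \<le> K * (m t)\<^sup>2"
      by (metis (no_types, lifting) Min_le finite_atLeastAtMost finite_imageI h(2) imageI order_trans)
    then show ?case by (metis mult.assoc mult_right_mono powr_ge_zero)
  qed
  have low: "eventually (\<lambda>t. 0 \<le> Min (h ` {1..t}) * real t powr \<theta>) sequentially"
    using eventually_ge_at_top[of 1]
    by eventually_elim (use h(1) in \<open>auto intro!: mult_nonneg_nonneg Min.boundedI\<close>)
  have lim: "(\<lambda>t. K * ((m t)\<^sup>2 * real t powr \<theta>)) \<longlonglongrightarrow> 0"
    using tendsto_mult_left[OF m2, of K] by simp
  have "(\<lambda>t. Min (h ` {1..t}) * real t powr \<theta>) \<longlonglongrightarrow> 0"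
    by (rule tendsto_sandwich[OF low up tendsto_const lim])
  then show ?thesis by (simp only: smallo_powr_neg_iff)
qed

section \<open>One-step bounds for energy and momentum\<close>

lemma energy_step:
  fixes f :: "'a::real_inner \<Rightarrow> real"
  assumes grad: "\<And>u. GDERIV f u :> g u"
    and lipschitz: "\<And>u w. norm (g u - g w) \<le> L * norm (u - w)" and L: "0 \<le> L"
    and k: "0 \<le> k" and a: "0 \<le> a" and zx: "norm (z - x) \<le> k * norm v"
  shows "f (z - (k * a) *\<^sub>R d) \<le> f z - k * a * (g x \<bullet> d) + k\<^sup>2 * L * ((norm v)\<^sup>2 + a\<^sup>2 * (norm d)\<^sup>2)"
proof -
  define r s where "r = norm v" and "s = a * norm d"
  have "f (z - (k * a) *\<^sub>R d) \<le> f z - k * a * (g z \<bullet> d) + L / 2 * (k * s)\<^sup>2"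
    using descent_lemma[OF grad lipschitz, of "z - (k * a) *\<^sub>R d" z] k a
    by (simp add: s_def abs_mult mult.assoc)
  \<comment> \<open>The descent lemma yields the gradient at \<open>z\<close>, but the direction is
    sampled at \<open>x\<close>; the exchange costs at most \<open>L * norm (z - x)\<close>, which
    \<open>zx\<close> expresses through the momentum.\<close>
  moreover have "k * a * (g x \<bullet> d - g z \<bullet> d) \<le> k\<^sup>2 * L * (r * s)"
  proof -
    have "g x \<bullet> d - g z \<bullet> d \<le> norm (g x - g z) * norm d"
      by (metis inner_diff_left norm_cauchy_schwarz)
    also have "\<dots> \<le> L * (k * r) * norm d"
      using lipschitz[of x z] mult_left_mono[OF zx L] by (intro mult_right_mono) (auto simp: r_def norm_minus_commute)
    finally have "k * a * (g x \<bullet> d - g z \<bullet> d) \<le> k * a * (L * (k * r) * norm d)"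
      using k a by (intro mult_left_mono) auto
    then show ?thesis by (simp add: s_def power2_eq_square ac_simps)
  qed
  \<comment> \<open>Young's inequality turns \<open>r * s\<close> into half of each square, and the
    second-order descent term supplies the missing half of \<open>s\<^sup>2\<close>.\<close>
  moreover have "k\<^sup>2 * L * (r * s) + L / 2 * (k * s)\<^sup>2 \<le> k\<^sup>2 * L * (r\<^sup>2 + s\<^sup>2)"
  proof -
    have "k\<^sup>2 * L * (r * s) + L / 2 * (k * s)\<^sup>2 = k\<^sup>2 * L * (r * s + s\<^sup>2 / 2)"
      by (simp add: power_mult_distrib algebra_simps)
    also have "\<dots> \<le> k\<^sup>2 * L * (r\<^sup>2 + s\<^sup>2)"
    proof (intro mult_left_mono)
      show "r * s + s\<^sup>2 / 2 \<le> r\<^sup>2 + s\<^sup>2"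
        using sum_squares_bound[of r s] zero_le_power2[of r] by linarith
    qed (use L in simp)
    finally show ?thesis .
  qed
  ultimately show ?thesis by (simp add: r_def s_def power_mult_distrib right_diff_distrib)
qed

text \<open>Rescaling the step by \<open>1 / (1 - \<beta>)\<close> bounds the new momentum by a
  convex combination with weights \<open>\<beta>\<close> and \<open>1 - \<beta>\<close>. Convexity
  of the square then keeps the contraction factor \<open>\<beta>\<close>, at the price of
  \<open>1 / (1 - \<beta>)\<close> on the squared step.\<close>

lemma norm_square_contraction:
  fixes v d :: "'a::real_inner"
  assumes \<beta>: "0 \<le> \<beta>" "\<beta> < 1" and a: "0 \<le> a"
  shows "(norm (\<beta> *\<^sub>R (v - a *\<^sub>R d)))\<^sup>2 \<le> \<beta> * (norm v)\<^sup>2 + 1 / (1 - \<beta>) * (a\<^sup>2 * (norm d)\<^sup>2)"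
proof -
  define r s where "r = norm v" and "s = a * norm d / (1 - \<beta>)"
  have "norm (v - a *\<^sub>R d) \<le> r + a * norm d"
    using norm_triangle_ineq4[of v "a *\<^sub>R d"] a by (simp add: r_def)
  also have "a * norm d = (1 - \<beta>) * s" using \<beta> by (simp add: s_def)
  finally have "norm (\<beta> *\<^sub>R (v - a *\<^sub>R d)) \<le> \<beta> * (r + (1 - \<beta>) * s)"
    using \<beta> by (simp add: mult_left_mono)
  also have "\<dots> \<le> \<beta> * r + (1 - \<beta>) * s"
    using \<beta> a mult_right_mono[of \<beta> 1 "(1 - \<beta>) * s"] by (simp add: s_def distrib_left)
  finally have "(norm (\<beta> *\<^sub>R (v - a *\<^sub>R d)))\<^sup>2 \<le> (\<beta> * r + (1 - \<beta>) * s)\<^sup>2"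
    by (intro power_mono) auto
  also have "\<dots> = \<beta> * r\<^sup>2 + (1 - \<beta>) * s\<^sup>2 - \<beta> * (1 - \<beta>) * (r - s)\<^sup>2"
    by (simp add: power2_eq_square algebra_simps)
  also have "\<dots> \<le> \<beta> * r\<^sup>2 + (1 - \<beta>) * s\<^sup>2" using \<beta> by simp
  also have "(1 - \<beta>) * s\<^sup>2 = 1 / (1 - \<beta>) * (a\<^sup>2 * (norm d)\<^sup>2)"
  proof -
    have "e * (w / e)\<^sup>2 = 1 / e * w\<^sup>2" if "e \<noteq> 0" for e w :: real
      using that by (simp add: power2_eq_square)
    from this[of "1 - \<beta>" "a * norm d"] show ?thesis using \<beta> by (simp add: s_def power_mult_distrib)
  qed
  finally show ?thesis by (simp add: r_def)
qed

section \<open>Moments, independence and conditioning\<close>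

lemma has_bochner_integral_standard_gaussian_coord:
  fixes b :: "'a::euclidean_space" and h :: "real \<Rightarrow> real"
  assumes b: "b \<in> Basis" and [measurable]: "h \<in> borel_measurable borel"
    and h: "has_bochner_integral lborel (\<lambda>y. std_normal_density y * h y) m"
  shows "has_bochner_integral
    (density lborel (\<lambda>x::'a. ennreal (\<Prod>c\<in>Basis. std_normal_density (x \<bullet> c)))) (\<lambda>x. h (x \<bullet> b)) m"
proof (rule has_bochner_integral_density)
  interpret product_sigma_finite "\<lambda>_::'a. lborel :: real measure" by standard
  \<comment> \<open>\<open>h\<close> is attached to the factor of coordinate \<open>b\<close> alone,
    so the product integral is \<open>m\<close> from that factor and total mass 1 (the zeroth
    moment) from each of the others.\<close>
  define k where "k c y = std_normal_density y * (if c = b then h y else 1)" for c :: 'a and y :: real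
  have k: "has_bochner_integral lborel (k c) (if c = b then m else 1)" for c
    using h std_normal_moment_even[of 0] by (auto simp: k_def[abs_def])
  have "has_bochner_integral (\<Pi>\<^sub>M c\<in>Basis. lborel) (\<lambda>p. \<Prod>c\<in>Basis. k c (p c))
      (\<Prod>c\<in>Basis. if c = b then m else 1)"
    using k by (auto simp: has_bochner_integral_iff intro!: product_integrable_prod
      product_integral_prod[THEN trans] prod.cong)
  also have "(\<Prod>c\<in>Basis. if c = b then m else 1) = m"
    using b by (simp add: prod.delta)
  also have "(\<lambda>p. \<Prod>c\<in>Basis. k c (p c)) =
      (\<lambda>p. (\<Prod>c\<in>Basis. std_normal_density (p c)) * h (p b))"
    using b by (simp add: k_def prod.distrib fun_eq_iff prod.delta if_distrib[of "\<lambda>f. f _"] cong: if_cong)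
  finally have "has_bochner_integral (\<Pi>\<^sub>M c\<in>Basis. lborel)
      (\<lambda>p. (\<Prod>c\<in>Basis. std_normal_density ((\<Sum>d\<in>Basis. p d *\<^sub>R d) \<bullet> (c::'a))) *\<^sub>R h ((\<Sum>d\<in>Basis. p d *\<^sub>R d) \<bullet> b)) m"
    using b by (simp add: inner_sum_left_Basis cong: prod.cong)
  \<comment> \<open>Lebesgue measure is the image of the product measure under the map that
    assembles a vector from its coordinates.\<close>
  then show "has_bochner_integral lborel
      (\<lambda>x::'a. (\<Prod>c\<in>Basis. std_normal_density (x \<bullet> c)) *\<^sub>R h (x \<bullet> b)) m"
    by (subst lborel_eq, intro has_bochner_integral_distr) simp_all
qed (auto intro!: prod_nonneg)

lemma isotropic_gaussian_coord_moments:
  fixes Z :: "'w \<Rightarrow> 'a::euclidean_space"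
  assumes [measurable]: "Z \<in> borel_measurable M"
    and Z: "distr M borel Z = isotropic_gaussian s" and b: "b \<in> Basis"
  shows "has_bochner_integral M (\<lambda>\<omega>. Z \<omega> \<bullet> b) 0"
    and "has_bochner_integral M (\<lambda>\<omega>. (Z \<omega> \<bullet> b)\<^sup>2) (s\<^sup>2)"
proof -
  \<comment> \<open>The scale \<open>s\<close> is moved into the test function, so
    \<open>s = 0\<close> is handled uniformly.\<close>
  have transfer: "has_bochner_integral M (\<lambda>\<omega>. h (Z \<omega> \<bullet> b)) m"
    if [measurable]: "h \<in> borel_measurable borel"
      and h: "has_bochner_integral lborel (\<lambda>y. std_normal_density y * h (s * y)) m"
    for h :: "real \<Rightarrow> real" and m
  proof -
    have "has_bochner_integral (distr M borel Z) (\<lambda>x. h (x \<bullet> b)) m"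
      unfolding Z isotropic_gaussian_def
      using has_bochner_integral_standard_gaussian_coord[OF b _ h]
      by (intro has_bochner_integral_distr) auto
    then show ?thesis by (simp add: has_bochner_integral_iff integrable_distr_eq integral_distr)
  qed
  show "has_bochner_integral M (\<lambda>\<omega>. Z \<omega> \<bullet> b) 0"
    using transfer[of "\<lambda>y. y" 0] has_bochner_integral_mult_right[OF std_normal_moment_odd[of 0], of s]
    by (simp add: ac_simps)
  show "has_bochner_integral M (\<lambda>\<omega>. (Z \<omega> \<bullet> b)\<^sup>2) (s\<^sup>2)"
    using transfer[of "\<lambda>y. y\<^sup>2" "s\<^sup>2"] has_bochner_integral_mult_right[OF std_normal_moment_even[of 1], of "s\<^sup>2"]
    by (simp add: ac_simps power_mult_distrib power2_eq_square)
qed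

text \<open>By monotone convergence the nonnegative series has finite expectation, hence is finite
  almost everywhere.\<close>

lemma AE_summable_of_summable_integral:
  fixes X :: "nat \<Rightarrow> 'w \<Rightarrow> real"
  assumes int: "\<And>t. integrable M (X t)" and nonneg: "\<And>t \<omega>. 0 \<le> X t \<omega>"
    and sum: "summable (\<lambda>t. \<integral>\<omega>. X t \<omega> \<partial>M)"
  shows "AE \<omega> in M. summable (\<lambda>t. X t \<omega>)"
proof -
  have [measurable]: "\<And>t. X t \<in> borel_measurable M" using int by auto
  have "(\<integral>\<^sup>+\<omega>. (\<Sum>t. ennreal (X t \<omega>)) \<partial>M) = (\<Sum>t. \<integral>\<^sup>+\<omega>. ennreal (X t \<omega>) \<partial>M)"
    by (rule nn_integral_suminf) measurable
  also have "\<dots> = (\<Sum>t. ennreal (\<integral>\<omega>. X t \<omega> \<partial>M))"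
    using int nonneg by (simp add: nn_integral_eq_integral)
  also have "\<dots> = ennreal (\<Sum>t. \<integral>\<omega>. X t \<omega> \<partial>M)"
    using sum nonneg by (intro suminf_ennreal2) auto
  finally have "AE \<omega> in M. (\<Sum>t. ennreal (X t \<omega>)) \<noteq> \<infinity>"
    by (intro nn_integral_noteq_infinite) auto
  then show ?thesis
    by (rule AE_mp) (use nonneg summable_suminf_not_top in \<open>auto simp: infinity_ennreal_def\<close>)
qed

text \<open>The events generated by \<open>h\<close> and by \<open>\<phi> (Z \<omega>)\<close> lie
  in the two independent families, so independence passes to these variables and the expectation
  factorises. With \<open>\<phi>\<close> a coordinate of centred noise, the product
  vanishes.\<close>

lemma (in prob_space) indep_of_past_and_expectation_mult:
  fixes h :: "'a \<Rightarrow> real" and \<phi> :: "'b::euclidean_space \<Rightarrow> real"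
  assumes indep: "indep_of_past_and M F X S Z" and F: "subalgebra M F"
    and [measurable]: "Z \<in> borel_measurable M" "\<phi> \<in> borel_measurable borel"
    and h: "h \<in> borel_measurable F" "integrable M h" and \<phi>: "integrable M (\<lambda>\<omega>. \<phi> (Z \<omega>))"
  shows "has_bochner_integral M (\<lambda>\<omega>. h \<omega> * \<phi> (Z \<omega>)) (expectation h * expectation (\<lambda>\<omega>. \<phi> (Z \<omega>)))"
proof -
  have space: "space F = space M" and sub: "sets F \<subseteq> sets M" using F by (auto simp: subalgebra_def)
  have "indep_var borel h borel (\<lambda>\<omega>. \<phi> (Z \<omega>))"
    unfolding indep_var_eq indep_set_def
  proof (intro conjI)
    let ?past = "sets (sigma (space M) (sets F \<union> sets (vimage_algebra (space M) X S)))"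
    let ?new = "sets (vimage_algebra (space M) Z borel)"
    have "{h -` A \<inter> space M |A. A \<in> sets borel} \<subseteq> sets F"
      using h(1) by (auto simp: space[symmetric] intro: measurable_sets)
    then have "sigma_sets (space M) {h -` A \<inter> space M |A. A \<in> sets borel} \<subseteq> sets F"
      using sets.sigma_sets_subset[of _ F] by (simp add: space)
    also have "sets F \<subseteq> ?past"
      using sets.space_closed[of F] sets.space_closed[of "vimage_algebra (space M) X S"]
      by (subst sets_measure_of) (auto simp: space)
    finally have past: "sigma_sets (space M) {h -` A \<inter> space M |A. A \<in> sets borel} \<subseteq> ?past" .
    have "(\<lambda>\<omega>. \<phi> (Z \<omega>)) \<in> borel_measurable (vimage_algebra (space M) Z borel)"
      by (rule measurable_compose[OF measurable_vimage_algebra1[of Z "space M" borel] assms(4)]) simp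
    then have "{(\<lambda>\<omega>. \<phi> (Z \<omega>)) -` A \<inter> space M |A. A \<in> sets borel} \<subseteq> ?new"
      by (auto dest: measurable_sets)
    then have new: "sigma_sets (space M) {(\<lambda>\<omega>. \<phi> (Z \<omega>)) -` A \<inter> space M |A. A \<in> sets borel} \<subseteq> ?new"
      using sets.sigma_sets_subset[of _ "vimage_algebra (space M) Z borel"] by simp
    show "indep_sets (case_bool
        (sigma_sets (space M) {h -` A \<inter> space M |A. A \<in> sets borel})
        (sigma_sets (space M) {(\<lambda>\<omega>. \<phi> (Z \<omega>)) -` A \<inter> space M |A. A \<in> sets borel})) UNIV"
      by (rule indep_sets_mono_sets[OF indep[unfolded indep_of_past_and_def indep_set_def]])
         (use past new in \<open>auto split: bool.split\<close>)
  qed (use h \<phi> in auto)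
  then show ?thesis
    using indep_var_lebesgue_integral indep_var_integrable h \<phi>
    by (auto simp: has_bochner_integral_iff)
qed

section \<open>Square integrable random vectors\<close>

definition square_integrable :: "'w measure \<Rightarrow> ('w \<Rightarrow> 'b::euclidean_space) \<Rightarrow> bool" where
  "square_integrable M X \<longleftrightarrow> X \<in> borel_measurable M \<and> integrable M (\<lambda>\<omega>. (norm (X \<omega>))\<^sup>2)"

lemma square_integrable_measurable: "square_integrable M X \<Longrightarrow> X \<in> borel_measurable M"
  and square_integrable_norm2: "square_integrable M X \<Longrightarrow> integrable M (\<lambda>\<omega>. (norm (X \<omega>))\<^sup>2)"
  by (auto simp: square_integrable_def)

lemma square_integrable_scaleR:
  "square_integrable M X \<Longrightarrow> square_integrable M (\<lambda>\<omega>. c *\<^sub>R X \<omega>)"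
  by (auto simp: square_integrable_def power_mult_distrib)

lemma norm_add_square_le: "(norm (a + b))\<^sup>2 \<le> 2 * (norm a)\<^sup>2 + 2 * (norm b)\<^sup>2"
  for a b :: "'a::real_inner"
proof -
  have "0 \<le> (norm (a - b))\<^sup>2" by simp
  then show ?thesis by (simp only: power2_norm_eq_inner) (simp add: inner_diff inner_add inner_commute)
qed

lemma square_integrable_add:
  assumes "square_integrable M X" "square_integrable M Y"
  shows "square_integrable M (\<lambda>\<omega>. X \<omega> + Y \<omega>)"
  unfolding square_integrable_def
proof
  show "(\<lambda>\<omega>. X \<omega> + Y \<omega>) \<in> borel_measurable M"
    using assms by (auto simp: square_integrable_def)
  show "integrable M (\<lambda>\<omega>. (norm (X \<omega> + Y \<omega>))\<^sup>2)"
  proof (rule Bochner_Integration.integrable_bound[rotated])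
    show "AE \<omega> in M. norm ((norm (X \<omega> + Y \<omega>))\<^sup>2) \<le> norm (2 * (norm (X \<omega>))\<^sup>2 + 2 * (norm (Y \<omega>))\<^sup>2)"
      using norm_add_square_le[of "X _" "Y _"] by (intro AE_I2) simp
  qed (use assms in \<open>auto simp: square_integrable_def\<close>)
qed

lemma square_integrable_diff:
  assumes "square_integrable M X" "square_integrable M Y"
  shows "square_integrable M (\<lambda>\<omega>. X \<omega> - Y \<omega>)"
  using square_integrable_add[OF assms(1) square_integrable_scaleR[OF assms(2), of "-1"]] by simp

text \<open>The constant term is harmless because the measure is finite. This passes square
  integrability from the Gaussian noise to \<open>gCN\<close>, and from the localised iterates to
  the exact and then the stochastic gradients.\<close>

lemma square_integrable_affine_bound:
  assumes fin: "finite_measure M" and X: "square_integrable M X"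
    and [measurable]: "Y \<in> borel_measurable M"
    and le: "AE \<omega> in M. norm (Y \<omega>) \<le> a + c * norm (X \<omega>)"
  shows "square_integrable M Y"
  unfolding square_integrable_def
proof
  have [measurable]: "X \<in> borel_measurable M" using X by (rule square_integrable_measurable)
  interpret finite_measure M by fact
  show "integrable M (\<lambda>\<omega>. (norm (Y \<omega>))\<^sup>2)"
  proof (rule Bochner_Integration.integrable_bound)
    show "integrable M (\<lambda>\<omega>. 2 * a\<^sup>2 + 2 * (c\<^sup>2 * (norm (X \<omega>))\<^sup>2))"
      using X by (auto simp: square_integrable_def)
    show "AE \<omega> in M. norm ((norm (Y \<omega>))\<^sup>2) \<le> norm (2 * a\<^sup>2 + 2 * (c\<^sup>2 * (norm (X \<omega>))\<^sup>2))"
      using le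
    proof eventually_elim
      case (elim \<omega>)
      then have "(norm (Y \<omega>))\<^sup>2 \<le> (norm (a + c * norm (X \<omega>)))\<^sup>2" by (intro power_mono) auto
      also have "\<dots> \<le> 2 * (norm a)\<^sup>2 + 2 * (norm (c * norm (X \<omega>)))\<^sup>2" by (rule norm_add_square_le)
      finally show ?case by (simp add: power_mult_distrib)
    qed
  qed measurable
qed fact

lemma integrable_square_integrable_inner:
  assumes "square_integrable M X" "square_integrable M Y"
  shows "integrable M (\<lambda>\<omega>. X \<omega> \<bullet> Y \<omega>)"
proof (rule Bochner_Integration.integrable_bound)
  show "integrable M (\<lambda>\<omega>. (norm (X \<omega>))\<^sup>2 + (norm (Y \<omega>))\<^sup>2)"
    using assms by (auto simp: square_integrable_def)
  show "AE \<omega> in M. norm (X \<omega> \<bullet> Y \<omega>) \<le> norm ((norm (X \<omega>))\<^sup>2 + (norm (Y \<omega>))\<^sup>2)"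
  proof (rule AE_I2)
    fix \<omega>
    have "\<bar>X \<omega> \<bullet> Y \<omega>\<bar> \<le> norm (X \<omega>) * norm (Y \<omega>)" by (rule Cauchy_Schwarz_ineq2)
    also have "\<dots> \<le> (norm (X \<omega>))\<^sup>2 + (norm (Y \<omega>))\<^sup>2"
      using sum_squares_bound[of "norm (X \<omega>)" "norm (Y \<omega>)"]
        mult_nonneg_nonneg[OF norm_ge_zero norm_ge_zero, of "X \<omega>" "Y \<omega>"] by linarith
    finally show "norm (X \<omega> \<bullet> Y \<omega>) \<le> norm ((norm (X \<omega>))\<^sup>2 + (norm (Y \<omega>))\<^sup>2)" by simp
  qed
qed (use assms in \<open>auto simp: square_integrable_def\<close>)

lemma integrable_square_integrable_coord:
  fixes X Y :: "'w \<Rightarrow> 'b::euclidean_space"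
  assumes "square_integrable M X" "square_integrable M Y" "b \<in> Basis"
  shows "integrable M (\<lambda>\<omega>. (X \<omega> \<bullet> b) * (Y \<omega> \<bullet> b))"
proof -
  have *: "square_integrable M (\<lambda>\<omega>. U \<omega> \<bullet> b)" if "square_integrable M U" for U :: "'w \<Rightarrow> 'b"
    unfolding square_integrable_def
  proof
    show m: "(\<lambda>\<omega>. U \<omega> \<bullet> b) \<in> borel_measurable M"
      using that by (auto simp: square_integrable_def)
    show "integrable M (\<lambda>\<omega>. (norm (U \<omega> \<bullet> b))\<^sup>2)"
      by (rule Bochner_Integration.integrable_bound[OF square_integrable_norm2[OF that]])
         (use m Basis_le_norm[OF assms(3)] in \<open>auto simp: abs_le_square_iff[symmetric]\<close>)
  qed
  show ?thesis
    using integrable_square_integrable_inner[OF *[OF assms(1)] *[OF assms(2)]] by (simp add: mult.commute)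
qed

text \<open>The characteristic property of conditional expectation, applied in each coordinate with
  the multiplier \<open>H \<omega> \<bullet> b\<close>. Integrability is asked of the products,
  since the stochastic gradient itself may fail to be integrable when the initial points are
  not.\<close>

lemma (in finite_measure_subalgebra) integral_inner_vec_cond_exp:
  fixes H X :: "'a \<Rightarrow> 'b::euclidean_space"
  assumes H: "H \<in> borel_measurable F" and X: "X \<in> borel_measurable M"
    and int: "\<And>b. b \<in> Basis \<Longrightarrow> integrable M (\<lambda>\<omega>. (H \<omega> \<bullet> b) * (X \<omega> \<bullet> b))"
  shows "(\<integral>\<omega>. H \<omega> \<bullet> X \<omega> \<partial>M) = (\<integral>\<omega>. H \<omega> \<bullet> vec_cond_exp M F X \<omega> \<partial>M)"
proof -
  have coord: "vec_cond_exp M F X \<omega> \<bullet> b = real_cond_exp M F (\<lambda>\<omega>. X \<omega> \<bullet> b) \<omega>" if "b \<in> Basis" for b \<omega>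
    using that by (simp add: vec_cond_exp_def inner_sum_left_Basis)
  have ce: "integrable M (\<lambda>\<omega>. (H \<omega> \<bullet> b) * real_cond_exp M F (\<lambda>\<omega>. X \<omega> \<bullet> b) \<omega>)"
    "(\<integral>\<omega>. (H \<omega> \<bullet> b) * real_cond_exp M F (\<lambda>\<omega>. X \<omega> \<bullet> b) \<omega> \<partial>M) = (\<integral>\<omega>. (H \<omega> \<bullet> b) * (X \<omega> \<bullet> b) \<partial>M)"
    if "b \<in> Basis" for b
    using real_cond_exp_intg[OF int[OF that]] H X by auto
  have "(\<integral>\<omega>. H \<omega> \<bullet> X \<omega> \<partial>M) = (\<Sum>b\<in>Basis. \<integral>\<omega>. (H \<omega> \<bullet> b) * (X \<omega> \<bullet> b) \<partial>M)"
    by (subst euclidean_inner) (use int in auto)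
  also have "\<dots> = (\<integral>\<omega>. H \<omega> \<bullet> vec_cond_exp M F X \<omega> \<partial>M)"
    by (subst (3) euclidean_inner) (use ce in \<open>simp add: coord cong: sum.cong\<close>)
  finally show ?thesis .
qed

section \<open>The natural filtration\<close>

lemma sets_natural_filtration:
  "sets (natural_filtration M ini I \<xi> S \<zeta> t) = sigma_sets (space M)
     (sets (vimage_algebra (space M) ini I)
        \<union> (\<Union>s\<in>{1..<t}. sets (vimage_algebra (space M) (\<xi> s) S))
        \<union> (\<Union>s\<in>{1..<t}. sets (vimage_algebra (space M) (\<zeta> s) borel)))"
  unfolding natural_filtration_def
  using sets.space_closed[of "vimage_algebra (space M) ini I"]
    sets.space_closed[of "vimage_algebra (space M) (\<xi> _) S"]
    sets.space_closed[of "vimage_algebra (space M) (\<zeta> _) borel"]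
  by (intro sets_measure_of Un_least UN_least) simp_all

lemma space_natural_filtration [simp]: "space (natural_filtration M ini I \<xi> S \<zeta> t) = space M"
  by (simp add: natural_filtration_def space_measure_of_conv)

lemma subalgebra_natural_filtration:
  assumes "ini \<in> measurable M I" "\<And>s. 1 \<le> s \<Longrightarrow> \<xi> s \<in> measurable M S"
    "\<And>s. 1 \<le> s \<Longrightarrow> \<zeta> s \<in> borel_measurable M"
  shows "subalgebra M (natural_filtration M ini I \<xi> S \<zeta> t)"
  unfolding subalgebra_def sets_natural_filtration
proof (intro conjI sets.sigma_sets_subset Un_least UN_least)
  have sub: "sets (vimage_algebra (space M) X N) \<subseteq> sets M" if "X \<in> measurable M N" for X :: "'a \<Rightarrow> 'x" and N
    using that measurable_space[OF that] by (subst sets_vimage_algebra2) (auto intro: measurable_sets)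
  show "sets (vimage_algebra (space M) ini I) \<subseteq> sets M"
    by (intro sub assms)
  show "sets (vimage_algebra (space M) (\<xi> s) S) \<subseteq> sets M" if "s \<in> {1..<t}" for s
    using that by (intro sub assms) auto
  show "sets (vimage_algebra (space M) (\<zeta> s) borel) \<subseteq> sets M" if "s \<in> {1..<t}" for s
    using that by (intro sub assms) auto
qed simp

lemma sets_natural_filtration_mono:
  "s \<le> t \<Longrightarrow> sets (natural_filtration M ini I \<xi> S \<zeta> s) \<subseteq> sets (natural_filtration M ini I \<xi> S \<zeta> t)"
  unfolding sets_natural_filtration by (intro sigma_sets_mono') force

lemma measurable_natural_filtration_sample:
  assumes "\<And>s. 1 \<le> s \<Longrightarrow> \<xi> s \<in> measurable M S" "1 \<le> s" "s < t"
  shows "\<xi> s \<in> measurable (natural_filtration M ini I \<xi> S \<zeta> t) S"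
proof (rule measurableI)
  fix A assume "A \<in> sets S"
  then have "\<xi> s -` A \<inter> space M \<in> sets (vimage_algebra (space M) (\<xi> s) S)" by (rule in_vimage_algebra)
  then show "\<xi> s -` A \<inter> space (natural_filtration M ini I \<xi> S \<zeta> t) \<in> sets (natural_filtration M ini I \<xi> S \<zeta> t)"
    unfolding sets_natural_filtration space_natural_filtration using assms(2,3)
    by (intro sigma_sets.Basic) auto
qed (use measurable_space[OF assms(1)[OF assms(2)]] in auto)

lemma measurable_natural_filtration_noise:
  fixes \<zeta> :: "nat \<Rightarrow> 'w \<Rightarrow> 'b::euclidean_space"
  assumes "1 \<le> s" "s < t"
  shows "\<zeta> s \<in> borel_measurable (natural_filtration M ini I \<xi> S \<zeta> t)"
proof (rule measurableI)
  fix A :: "'b set" assume "A \<in> sets borel"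
  then have "\<zeta> s -` A \<inter> space M \<in> sets (vimage_algebra (space M) (\<zeta> s) borel)" by (rule in_vimage_algebra)
  then show "\<zeta> s -` A \<inter> space (natural_filtration M ini I \<xi> S \<zeta> t) \<in> sets (natural_filtration M ini I \<xi> S \<zeta> t)"
    unfolding sets_natural_filtration space_natural_filtration using assms
    by (intro sigma_sets.Basic) auto
qed auto

lemma clip_measurable [measurable]: "clip q \<in> borel_measurable borel"
  unfolding clip_def[abs_def] by measurable

lemma Psi_measurable [measurable]: "Psi q \<in> borel_measurable borel"
  unfolding Psi_def[abs_def] by measurable

section \<open>The clipped noisy accelerated gradient process\<close>

text \<open>The setting for the almost sure summability results. Step sizes enter through positivity
  and square summability; their order and monotonicity come in later, when summability is turned
  into rates.\<close>

locale snag_cn = prob_space M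
  for M :: "'w measure" +
  fixes f :: "'a::euclidean_space \<Rightarrow> real" and gradf :: "'a \<Rightarrow> 'a"
    and fstar L \<sigma>g q \<beta> \<sigma>CN :: real
    and \<alpha> :: "nat \<Rightarrow> real"
    and S :: "'s measure" and I :: "'i measure"
    and G :: "'a \<Rightarrow> 's \<Rightarrow> 'a"
    and ini :: "'w \<Rightarrow> 'i" and \<xi> :: "nat \<Rightarrow> 'w \<Rightarrow> 's"
    and \<zeta> x y v z gCN :: "nat \<Rightarrow> 'w \<Rightarrow> 'a"
    and F :: "nat \<Rightarrow> 'w measure"
  assumes grad: "\<And>u. GDERIV f u :> gradf u"
    and lipschitz: "\<And>u w. norm (gradf u - gradf w) \<le> L * norm (u - w)"
    and fstar_lower: "\<And>u. fstar \<le> f u"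
    and \<sigma>g_less: "\<sigma>g < q" and q_pos: "0 < q" and \<beta>: "0 \<le> \<beta>" "\<beta> < 1"
    and step_pos: "\<And>t. 1 \<le> t \<Longrightarrow> 0 < \<alpha> t"
    and step_square_summable: "summable (\<lambda>t. (\<alpha> t)\<^sup>2)"
    and G_measurable [measurable]: "(\<lambda>(u, s). G u s) \<in> borel_measurable (borel \<Otimes>\<^sub>M S)"
    and ini_measurable: "ini \<in> measurable M I"
    and \<xi>_measurable: "\<And>t. 1 \<le> t \<Longrightarrow> \<xi> t \<in> measurable M S"
    and \<zeta>_measurable: "\<And>t. 1 \<le> t \<Longrightarrow> \<zeta> t \<in> borel_measurable M"
    and F_def: "\<And>t. F t = natural_filtration M ini I \<xi> S \<zeta> t"
    and \<zeta>_gaussian: "\<And>t. 1 \<le> t \<Longrightarrow> distr M borel (\<zeta> t) = isotropic_gaussian \<sigma>CN"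
    and \<zeta>_indep: "\<And>t. 1 \<le> t \<Longrightarrow> indep_of_past_and M (F t) (\<xi> t) S (\<zeta> t)"
    and y0_measurable: "y 0 \<in> borel_measurable (F 1)"
    and y1_measurable: "y 1 \<in> borel_measurable (F 1)"
    and x1: "\<And>\<omega>. x 1 \<omega> = y 1 \<omega> + \<beta> *\<^sub>R (y 1 \<omega> - y 0 \<omega>)"
    and gCN_def: "\<And>t \<omega>. 1 \<le> t \<Longrightarrow> gCN t \<omega> = clip q (G (x t \<omega>) (\<xi> t \<omega>)) + q *\<^sub>R \<zeta> t \<omega>"
    and y_step: "\<And>t \<omega>. 1 \<le> t \<Longrightarrow> y (t + 1) \<omega> = x t \<omega> - \<alpha> t *\<^sub>R gCN t \<omega>"
    and x_step: "\<And>t \<omega>. 1 \<le> t \<Longrightarrow> x (t + 1) \<omega> = y (t + 1) \<omega> + \<beta> *\<^sub>R (y (t + 1) \<omega> - y t \<omega>)"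
    and v_def: "\<And>t \<omega>. 1 \<le> t \<Longrightarrow> v t \<omega> = \<beta> *\<^sub>R (y t \<omega> - y (t - 1) \<omega>)"
    and z_def: "\<And>t \<omega>. 1 \<le> t \<Longrightarrow> z t \<omega> = x t \<omega> + (\<beta> / (1 - \<beta>)) *\<^sub>R v t \<omega>"
    and unbiased: "\<And>t. 1 \<le> t \<Longrightarrow>
      AE \<omega> in M. vec_cond_exp M (F t) (\<lambda>\<omega>. G (x t \<omega>) (\<xi> t \<omega>)) \<omega> = gradf (x t \<omega>)"
    and bounded_noise_iterates:
      "\<And>t. 1 \<le> t \<Longrightarrow> AE \<omega> in M. norm (G (x t \<omega>) (\<xi> t \<omega>) - gradf (x t \<omega>)) \<le> \<sigma>g"
begin

abbreviation stoch_grad :: "nat \<Rightarrow> 'w \<Rightarrow> 'a" where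
  "stoch_grad t \<omega> \<equiv> G (x t \<omega>) (\<xi> t \<omega>)"

abbreviation \<kappa> :: real where
  "\<kappa> \<equiv> 1 / (1 - \<beta>)"

lemma step_square_summable_Suc: "summable (\<lambda>t. (\<alpha> (Suc t))\<^sup>2)"
  using step_square_summable summable_Suc_iff[of "\<lambda>t. (\<alpha> t)\<^sup>2"] by simp

lemma L_nonneg: "0 \<le> L"
proof -
  \<comment> \<open>For a unit vector \<open>b\<close> the Lipschitz bound against 0 has right-hand
    side \<open>L\<close>.\<close>
  obtain b :: 'a where "b \<in> Basis" using nonempty_Basis by blast
  then show ?thesis using lipschitz[of b 0] order_trans[OF norm_ge_zero] by fastforce
qed

lemma gradf_measurable [measurable]: "gradf \<in> borel_measurable borel"
proof (rule borel_measurable_continuous_onI)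
  have "L-lipschitz_on UNIV gradf"
    by (rule lipschitz_onI) (use lipschitz L_nonneg in \<open>auto simp: dist_norm\<close>)
  then show "continuous_on UNIV gradf" by (rule lipschitz_on_continuous_on)
qed

lemma f_measurable [measurable]: "f \<in> borel_measurable borel"
  by (rule borel_measurable_continuous_onI)
     (use grad in \<open>auto intro!: continuous_at_imp_continuous_on has_derivative_continuous simp: gderiv_def\<close>)

lemma F_subalgebra: "subalgebra M (F t)"
  unfolding F_def by (rule subalgebra_natural_filtration[OF ini_measurable \<xi>_measurable \<zeta>_measurable])

lemma measurable_F_mono: "s \<le> t \<Longrightarrow> X \<in> measurable (F s) N \<Longrightarrow> X \<in> measurable (F t) N"
  using sets_natural_filtration_mono[of s t M ini I \<xi> S \<zeta>]
  by (intro measurable_from_subalg[of "F t" "F s"]) (auto simp: F_def subalgebra_def)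

lemma measurable_F_imp: "X \<in> measurable (F t) N \<Longrightarrow> X \<in> measurable M N"
  by (rule measurable_from_subalg[OF F_subalgebra])

lemma x_eq: "1 \<le> t \<Longrightarrow> x t \<omega> = y t \<omega> + v t \<omega>"
  using x1[of \<omega>] x_step[of "t - 1" \<omega>] v_def[of t \<omega>] by (cases "t = 1") auto

lemma v_step: "1 \<le> t \<Longrightarrow> v (Suc t) \<omega> = \<beta> *\<^sub>R (v t \<omega> - \<alpha> t *\<^sub>R gCN t \<omega>)"
proof -
  assume t: "1 \<le> t"
  have "y (Suc t) \<omega> - y t \<omega> = v t \<omega> - \<alpha> t *\<^sub>R gCN t \<omega>"
    using y_step[OF t, of \<omega>] x_eq[OF t, of \<omega>] by simp
  then show ?thesis using v_def[of "Suc t" \<omega>] by simp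
qed

text \<open>With \<open>z t = y t + \<kappa> *\<^sub>R v t\<close> and
  \<open>\<kappa> = 1 + \<kappa> * \<beta>\<close>, the momentum terms recombine into
  \<open>z t\<close>, and what is left is a plain step of length
  \<open>\<kappa> * \<alpha> t\<close>.\<close>

lemma z_step: "1 \<le> t \<Longrightarrow> z (Suc t) \<omega> = z t \<omega> - (\<kappa> * \<alpha> t) *\<^sub>R gCN t \<omega>"
proof -
  assume t: "1 \<le> t"
  have \<kappa>: "\<kappa> = 1 + \<beta> / (1 - \<beta>)" using \<beta> by (simp add: field_simps)
  have z: "z s \<omega> = y s \<omega> + \<kappa> *\<^sub>R v s \<omega>" if "1 \<le> s" for s
    using z_def[OF that, of \<omega>] x_eq[OF that, of \<omega>] by (simp add: \<kappa> scaleR_add_left)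
  have "z (Suc t) \<omega> = x t \<omega> - \<alpha> t *\<^sub>R gCN t \<omega> + (\<kappa> * \<beta>) *\<^sub>R (v t \<omega> - \<alpha> t *\<^sub>R gCN t \<omega>)"
    using z[of "Suc t"] y_step[OF t, of \<omega>] v_step[OF t, of \<omega>] by simp
  also have "\<dots> = z t \<omega> - (1 + \<beta> / (1 - \<beta>)) *\<^sub>R (\<alpha> t *\<^sub>R gCN t \<omega>)"
    using z_def[OF t, of \<omega>] by (simp add: distrib_right scaleR_add_left scaleR_diff_right)
  finally show ?thesis by (simp add: \<kappa>)
qed

section \<open>Adaptedness and measurability of the process\<close>

lemma iterates_measurable:
  "1 \<le> t \<Longrightarrow> x t \<in> borel_measurable (F t) \<and> y t \<in> borel_measurable (F t) \<and> y (t - 1) \<in> borel_measurable (F t)"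
proof (induction t rule: nat_induct_at_least)
  case base
  have "x 1 = (\<lambda>\<omega>. y 1 \<omega> + \<beta> *\<^sub>R (y 1 \<omega> - y 0 \<omega>))" using x1 by blast
  then show ?case using y0_measurable y1_measurable by simp
next
  case (Suc t)
  \<comment> \<open>The filtration at index \<open>Suc t\<close> records the samples up to
    \<open>t\<close>, which is what the update to \<open>Suc t\<close> consumes.\<close>
  have \<xi>: "\<xi> t \<in> measurable (F (Suc t)) S" and \<zeta>: "\<zeta> t \<in> borel_measurable (F (Suc t))"
    unfolding F_def using Suc.hyps
    by (auto intro: measurable_natural_filtration_sample[OF \<xi>_measurable] measurable_natural_filtration_noise)
  have xt: "x t \<in> borel_measurable (F (Suc t))" and yt: "y t \<in> borel_measurable (F (Suc t))"
    using Suc.IH measurable_F_mono[of t "Suc t"] by auto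
  have "(\<lambda>\<omega>. stoch_grad t \<omega>) \<in> borel_measurable (F (Suc t))"
    using measurable_compose[OF measurable_Pair[OF xt \<xi>] G_measurable] by simp
  with \<zeta> have "(\<lambda>\<omega>. clip q (stoch_grad t \<omega>) + q *\<^sub>R \<zeta> t \<omega>) \<in> borel_measurable (F (Suc t))"
    by measurable
  with xt have "(\<lambda>\<omega>. x t \<omega> - \<alpha> t *\<^sub>R (clip q (stoch_grad t \<omega>) + q *\<^sub>R \<zeta> t \<omega>)) \<in> borel_measurable (F (Suc t))"
    by measurable
  moreover have "y (Suc t) = (\<lambda>\<omega>. x t \<omega> - \<alpha> t *\<^sub>R (clip q (stoch_grad t \<omega>) + q *\<^sub>R \<zeta> t \<omega>))"
    using y_step[OF Suc.hyps] gCN_def[OF Suc.hyps] by auto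
  ultimately have ySt: "y (Suc t) \<in> borel_measurable (F (Suc t))" by simp
  have "x (Suc t) = (\<lambda>\<omega>. y (Suc t) \<omega> + \<beta> *\<^sub>R (y (Suc t) \<omega> - y t \<omega>))"
    using x_step[OF Suc.hyps] by auto
  with ySt yt show ?case by simp
qed

lemma x_measurable: "1 \<le> t \<Longrightarrow> x t \<in> borel_measurable M"
  and y_measurable: "1 \<le> t \<Longrightarrow> y t \<in> borel_measurable M"
  using iterates_measurable measurable_F_imp by blast+

lemma stoch_grad_measurable: "1 \<le> t \<Longrightarrow> stoch_grad t \<in> borel_measurable M"
  using measurable_compose[OF measurable_Pair[OF x_measurable \<xi>_measurable] G_measurable] by simp

lemma v_measurable: "1 \<le> t \<Longrightarrow> v t \<in> borel_measurable M"
proof -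
  assume t: "1 \<le> t"
  have "v t = (\<lambda>\<omega>. x t \<omega> - y t \<omega>)" using x_eq[OF t] by auto
  then show ?thesis using x_measurable[OF t] y_measurable[OF t] by simp
qed

lemma z_measurable: "1 \<le> t \<Longrightarrow> z t \<in> borel_measurable M"
proof -
  assume t: "1 \<le> t"
  have "z t = (\<lambda>\<omega>. x t \<omega> + (\<beta> / (1 - \<beta>)) *\<^sub>R v t \<omega>)" using z_def[OF t] by auto
  then show ?thesis using x_measurable[OF t] v_measurable[OF t] by simp
qed

lemma gCN_measurable: "1 \<le> t \<Longrightarrow> gCN t \<in> borel_measurable M"
proof -
  assume t: "1 \<le> t"
  note [measurable] = stoch_grad_measurable[OF t] \<zeta>_measurable[OF t]
  have "gCN t = (\<lambda>\<omega>. clip q (stoch_grad t \<omega>) + q *\<^sub>R \<zeta> t \<omega>)" using gCN_def[OF t] by auto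
  then show ?thesis by simp
qed

section \<open>Second moments of the update directions\<close>

lemma noise_second_moment:
  assumes t: "1 \<le> t"
  shows "has_bochner_integral M (\<lambda>\<omega>. (norm (\<zeta> t \<omega>))\<^sup>2) (DIM('a) * \<sigma>CN\<^sup>2)"
proof -
  have "has_bochner_integral M (\<lambda>\<omega>. \<Sum>b\<in>Basis. (\<zeta> t \<omega> \<bullet> b)\<^sup>2) (\<Sum>b\<in>(Basis::'a set). \<sigma>CN\<^sup>2)"
    by (intro has_bochner_integral_sum isotropic_gaussian_coord_moments(2)[OF \<zeta>_measurable \<zeta>_gaussian] t)
  moreover have "(norm u)\<^sup>2 = (\<Sum>b\<in>Basis. (u \<bullet> b)\<^sup>2)" for u :: 'a
    unfolding power2_norm_eq_inner by (subst euclidean_inner) (simp add: power2_eq_square)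
  ultimately show ?thesis by simp
qed

text \<open>Twice the squared clipping level plus twice the second moment of the scaled Gaussian.
  Clipping makes this bound uniform in time, however large the gradients are.\<close>

definition B :: real where
  "B = 2 * q\<^sup>2 + 2 * (q\<^sup>2 * (DIM('a) * \<sigma>CN\<^sup>2))"

lemma gCN_second_moment:
  assumes t: "1 \<le> t"
  shows "square_integrable M (gCN t)" and "(\<integral>\<omega>. (norm (gCN t \<omega>))\<^sup>2 \<partial>M) \<le> B"
proof -
  have \<zeta>: "square_integrable M (\<zeta> t)"
    using noise_second_moment[OF t] \<zeta>_measurable[OF t]
    by (auto simp: square_integrable_def has_bochner_integral_iff)
  have clip: "norm (clip q (stoch_grad t \<omega>)) \<le> q" for \<omega>
    using q_pos by (intro norm_clip_le) simp
  have "norm (gCN t \<omega>) \<le> q + q * norm (\<zeta> t \<omega>)" for \<omega>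
    using clip[of \<omega>] norm_triangle_ineq[of "clip q (stoch_grad t \<omega>)" "q *\<^sub>R \<zeta> t \<omega>"] q_pos
    by (simp add: gCN_def[OF t])
  then show sq: "square_integrable M (gCN t)"
    by (intro square_integrable_affine_bound[OF finite_measure_axioms \<zeta> gCN_measurable[OF t]] AE_I2)
  have "(\<integral>\<omega>. (norm (gCN t \<omega>))\<^sup>2 \<partial>M) \<le> (\<integral>\<omega>. 2 * q\<^sup>2 + 2 * (q\<^sup>2 * (norm (\<zeta> t \<omega>))\<^sup>2) \<partial>M)"
  proof (rule integral_mono)
    fix \<omega>
    have "(norm (gCN t \<omega>))\<^sup>2 \<le> 2 * (norm (clip q (stoch_grad t \<omega>)))\<^sup>2 + 2 * (norm (q *\<^sub>R \<zeta> t \<omega>))\<^sup>2"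
      unfolding gCN_def[OF t] by (rule norm_add_square_le)
    also have "\<dots> \<le> 2 * q\<^sup>2 + 2 * (q\<^sup>2 * (norm (\<zeta> t \<omega>))\<^sup>2)"
      using power_mono[OF clip norm_ge_zero, of \<omega> 2] by (simp add: power_mult_distrib)
    finally show "(norm (gCN t \<omega>))\<^sup>2 \<le> 2 * q\<^sup>2 + 2 * (q\<^sup>2 * (norm (\<zeta> t \<omega>))\<^sup>2)" .
  qed (use sq \<zeta> in \<open>auto simp: square_integrable_def\<close>)
  also have "\<dots> = B"
    using noise_second_moment[OF t] by (simp add: has_bochner_integral_iff B_def prob_space)
  finally show "(\<integral>\<omega>. (norm (gCN t \<omega>))\<^sup>2 \<partial>M) \<le> B" .
qed

lemma square_integrable_const: "square_integrable M (\<lambda>_. c)"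
  by (simp add: square_integrable_def)

section \<open>Localisation to bounded initial points\<close>

context
  fixes N :: real
begin

text \<open>
  On this \<open>F 1\<close>-measurable event all iterates are square integrable, so that plain expectations
  can be taken; as \<open>N\<close> grows, the events exhaust the space.
\<close>
definition J :: "'w \<Rightarrow> real" where
  "J = indicator {\<omega> \<in> space M. norm (y 0 \<omega>) \<le> N \<and> norm (y 1 \<omega>) \<le> N}"

lemma J_measurable_F: "1 \<le> t \<Longrightarrow> J \<in> borel_measurable (F t)"
proof (rule measurable_F_mono)
  note [measurable] = y0_measurable y1_measurable
  have "space (F 1) = space M" by (simp add: F_def)
  then have "J = indicator {\<omega> \<in> space (F 1). norm (y 0 \<omega>) \<le> N \<and> norm (y 1 \<omega>) \<le> N}"
    by (simp add: J_def)
  also have "\<dots> \<in> borel_measurable (F 1)" by measurable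
  finally show "J \<in> borel_measurable (F 1)" .
qed

lemma J_measurable [measurable]: "J \<in> borel_measurable M"
  using measurable_F_imp[OF J_measurable_F[of 1]] by simp

lemma J_cases: "J \<omega> = 0 \<or> J \<omega> = 1" and J_nonneg: "0 \<le> J \<omega>" and J_le: "J \<omega> \<le> 1"
  by (auto simp: J_def indicator_def)

lemma J_power2: "(J \<omega>)\<^sup>2 = J \<omega>"
  using J_cases[of \<omega>] by auto

lemma square_integrable_J:
  assumes "square_integrable M X"
  shows "square_integrable M (\<lambda>\<omega>. J \<omega> *\<^sub>R X \<omega>)"
proof (rule square_integrable_affine_bound[OF finite_measure_axioms assms])
  show "(\<lambda>\<omega>. J \<omega> *\<^sub>R X \<omega>) \<in> borel_measurable M"
    using square_integrable_measurable[OF assms] by simp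
  show "AE \<omega> in M. norm (J \<omega> *\<^sub>R X \<omega>) \<le> 0 + 1 * norm (X \<omega>)"
    using J_le J_nonneg by (auto intro!: AE_I2 mult_left_le_one_le)
qed

text \<open>Localising once, at time 1, serves all later times: the initial points are bounded where
  \<open>J\<close> is 1, and each update is linear in earlier iterates and the square integrable
  \<open>gCN t\<close>.\<close>

lemma square_integrable_J_xy:
  "1 \<le> t \<Longrightarrow> square_integrable M (\<lambda>\<omega>. J \<omega> *\<^sub>R x t \<omega>) \<and> square_integrable M (\<lambda>\<omega>. J \<omega> *\<^sub>R y t \<omega>)"
proof (induction t rule: nat_induct_at_least)
  case base
  have y: "square_integrable M (\<lambda>\<omega>. J \<omega> *\<^sub>R y i \<omega>)" if "i = 0 \<or> i = 1" for i
  proof (rule square_integrable_affine_bound[OF finite_measure_axioms square_integrable_const])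
    have "y i \<in> borel_measurable M" using that measurable_F_imp[OF y0_measurable] measurable_F_imp[OF y1_measurable] by blast
    then show "(\<lambda>\<omega>. J \<omega> *\<^sub>R y i \<omega>) \<in> borel_measurable M" by measurable
    \<comment> \<open>The absolute value covers negative \<open>N\<close>, for which
      \<open>J\<close> vanishes; the affine bound is used with slope 0.\<close>
    show "AE \<omega> in M. norm (J \<omega> *\<^sub>R y i \<omega>) \<le> \<bar>N\<bar> + 0 * norm (0::real)"
      using that by (auto intro!: AE_I2 simp: J_def indicator_def)
  qed
  have "(\<lambda>\<omega>. J \<omega> *\<^sub>R x 1 \<omega>) = (\<lambda>\<omega>. J \<omega> *\<^sub>R y 1 \<omega> + \<beta> *\<^sub>R (J \<omega> *\<^sub>R y 1 \<omega> - J \<omega> *\<^sub>R y 0 \<omega>))"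
    unfolding x1 by (simp add: algebra_simps)
  then show ?case using y by (auto intro!: square_integrable_add square_integrable_scaleR square_integrable_diff)
next
  case (Suc t)
  have "(\<lambda>\<omega>. J \<omega> *\<^sub>R y (Suc t) \<omega>) = (\<lambda>\<omega>. J \<omega> *\<^sub>R x t \<omega> - \<alpha> t *\<^sub>R (J \<omega> *\<^sub>R gCN t \<omega>))"
    by (simp add: y_step[OF Suc.hyps, simplified] algebra_simps)
  then have y: "square_integrable M (\<lambda>\<omega>. J \<omega> *\<^sub>R y (Suc t) \<omega>)"
    using Suc gCN_second_moment(1)[OF Suc.hyps]
    by (auto intro!: square_integrable_scaleR square_integrable_diff square_integrable_J simp del: scaleR_scaleR)
  have "(\<lambda>\<omega>. J \<omega> *\<^sub>R x (Suc t) \<omega>) =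
      (\<lambda>\<omega>. J \<omega> *\<^sub>R y (Suc t) \<omega> + \<beta> *\<^sub>R (J \<omega> *\<^sub>R y (Suc t) \<omega> - J \<omega> *\<^sub>R y t \<omega>))"
    by (simp add: x_step[OF Suc.hyps, simplified] algebra_simps)
  then show ?case
    using y Suc by (auto intro!: square_integrable_add square_integrable_scaleR square_integrable_diff)
qed

lemma square_integrable_J_v: "1 \<le> t \<Longrightarrow> square_integrable M (\<lambda>\<omega>. J \<omega> *\<^sub>R v t \<omega>)"
proof -
  assume t: "1 \<le> t"
  have "(\<lambda>\<omega>. J \<omega> *\<^sub>R v t \<omega>) = (\<lambda>\<omega>. J \<omega> *\<^sub>R x t \<omega> - J \<omega> *\<^sub>R y t \<omega>)"
    using x_eq[OF t] by (auto simp: scaleR_add_right)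
  then show ?thesis using square_integrable_J_xy[OF t] by (auto intro: square_integrable_diff)
qed

lemma integrable_J_norm2:
  "square_integrable M (\<lambda>\<omega>. J \<omega> *\<^sub>R X \<omega>) \<Longrightarrow> integrable M (\<lambda>\<omega>. J \<omega> * (norm (X \<omega>))\<^sup>2)"
  by (auto simp: square_integrable_def power_mult_distrib J_power2)

lemma square_integrable_J_gradf:
  assumes t: "1 \<le> t"
  shows "square_integrable M (\<lambda>\<omega>. J \<omega> *\<^sub>R gradf (x t \<omega>))"
proof (rule square_integrable_affine_bound[OF finite_measure_axioms])
  show "square_integrable M (\<lambda>\<omega>. J \<omega> *\<^sub>R x t \<omega>)" using square_integrable_J_xy[OF t] by simp
  note [measurable] = x_measurable[OF t]
  show "(\<lambda>\<omega>. J \<omega> *\<^sub>R gradf (x t \<omega>)) \<in> borel_measurable M" by measurable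
  show "AE \<omega> in M. norm (J \<omega> *\<^sub>R gradf (x t \<omega>)) \<le> norm (gradf 0) + L * norm (J \<omega> *\<^sub>R x t \<omega>)"
  proof (rule AE_I2)
    fix \<omega>
    have "norm (gradf (x t \<omega>)) \<le> norm (gradf 0) + L * norm (x t \<omega>)"
      using lipschitz[of "x t \<omega>" 0] norm_triangle_sub[of "gradf (x t \<omega>)" "gradf 0"] by simp
    then show "norm (J \<omega> *\<^sub>R gradf (x t \<omega>)) \<le> norm (gradf 0) + L * norm (J \<omega> *\<^sub>R x t \<omega>)"
      using J_cases[of \<omega>] by auto
  qed
qed

lemma square_integrable_J_stoch_grad:
  assumes t: "1 \<le> t"
  shows "square_integrable M (\<lambda>\<omega>. J \<omega> *\<^sub>R stoch_grad t \<omega>)"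
proof (rule square_integrable_affine_bound[OF finite_measure_axioms square_integrable_J_gradf[OF t]])
  note [measurable] = stoch_grad_measurable[OF t]
  show "(\<lambda>\<omega>. J \<omega> *\<^sub>R stoch_grad t \<omega>) \<in> borel_measurable M" by measurable
  show "AE \<omega> in M. norm (J \<omega> *\<^sub>R stoch_grad t \<omega>) \<le> \<bar>\<sigma>g\<bar> + 1 * norm (J \<omega> *\<^sub>R gradf (x t \<omega>))"
    using bounded_noise_iterates[OF t]
  proof eventually_elim
    case (elim \<omega>)
    then have "norm (stoch_grad t \<omega>) \<le> \<bar>\<sigma>g\<bar> + norm (gradf (x t \<omega>))"
      using norm_triangle_sub[of "stoch_grad t \<omega>" "gradf (x t \<omega>)"] by linarith
    then show ?case using J_cases[of \<omega>] by auto
  qed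
qed

lemma gradf_F_measurable: "1 \<le> t \<Longrightarrow> (\<lambda>\<omega>. J \<omega> *\<^sub>R gradf (x t \<omega>)) \<in> borel_measurable (F t)"
  using measurable_compose[OF _ gradf_measurable, of "x t" "F t"] iterates_measurable[of t] J_measurable_F[of t]
  by simp

section \<open>The two noise terms have mean zero\<close>

lemma sampling_noise_orthogonal:
  assumes t: "1 \<le> t"
  shows "has_bochner_integral M (\<lambda>\<omega>. J \<omega> * (gradf (x t \<omega>) \<bullet> (stoch_grad t \<omega> - gradf (x t \<omega>)))) 0"
proof -
  define H where "H \<omega> = J \<omega> *\<^sub>R gradf (x t \<omega>)" for \<omega>
  have H: "square_integrable M H" "H \<in> borel_measurable (F t)"
    using square_integrable_J_gradf[OF t] gradf_F_measurable[OF t] by (simp_all add: H_def[abs_def])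
  interpret finite_measure_subalgebra M "F t"
    by unfold_locales (rule F_subalgebra)
  have HJ: "J \<omega> *\<^sub>R H \<omega> = H \<omega>" for \<omega> using J_cases[of \<omega>] by (auto simp: H_def)
  \<comment> \<open>Since \<open>J\<close> takes only the values 0 and 1, a second factor
    \<open>J\<close> changes nothing, and the square integrability of the localised gradients
    becomes applicable.\<close>
  have inner_J: "H \<omega> \<bullet> (J \<omega> *\<^sub>R u) = H \<omega> \<bullet> u" "(H \<omega> \<bullet> b) * ((J \<omega> *\<^sub>R u) \<bullet> b) = (H \<omega> \<bullet> b) * (u \<bullet> b)" for \<omega> u b
    using J_cases[of \<omega>] by (auto simp: H_def)
  have int_HG: "integrable M (\<lambda>\<omega>. H \<omega> \<bullet> stoch_grad t \<omega>)"
    using integrable_square_integrable_inner[OF H(1) square_integrable_J_stoch_grad[OF t]] by (simp add: inner_J del: inner_scaleR_right)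
  have int_Hg: "integrable M (\<lambda>\<omega>. H \<omega> \<bullet> gradf (x t \<omega>))"
    using integrable_square_integrable_inner[OF H(1) square_integrable_J_gradf[OF t]] by (simp add: inner_J del: inner_scaleR_right)
  have "(\<integral>\<omega>. H \<omega> \<bullet> stoch_grad t \<omega> \<partial>M) = (\<integral>\<omega>. H \<omega> \<bullet> vec_cond_exp M (F t) (stoch_grad t) \<omega> \<partial>M)"
  proof (rule integral_inner_vec_cond_exp[OF H(2) stoch_grad_measurable[OF t]])
    fix b :: 'a assume "b \<in> Basis"
    from integrable_square_integrable_coord[OF H(1) square_integrable_J_stoch_grad[OF t] this]
    show "integrable M (\<lambda>\<omega>. (H \<omega> \<bullet> b) * (stoch_grad t \<omega> \<bullet> b))" by (simp add: inner_J del: inner_scaleR_left)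
  qed
  also have "\<dots> = (\<integral>\<omega>. H \<omega> \<bullet> gradf (x t \<omega>) \<partial>M)"
  proof (rule integral_cong_AE)
    note [measurable] = square_integrable_measurable[OF H(1)] x_measurable[OF t]
    show "(\<lambda>\<omega>. H \<omega> \<bullet> vec_cond_exp M (F t) (stoch_grad t) \<omega>) \<in> borel_measurable M"
      unfolding vec_cond_exp_def using stoch_grad_measurable[OF t] by measurable
    show "(\<lambda>\<omega>. H \<omega> \<bullet> gradf (x t \<omega>)) \<in> borel_measurable M" by measurable
    show "AE \<omega> in M. H \<omega> \<bullet> vec_cond_exp M (F t) (stoch_grad t) \<omega> = H \<omega> \<bullet> gradf (x t \<omega>)"
      using unbiased[OF t] by eventually_elim simp
  qed
  finally have "has_bochner_integral M (\<lambda>\<omega>. H \<omega> \<bullet> (stoch_grad t \<omega> - gradf (x t \<omega>))) 0"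
    using int_HG int_Hg by (simp add: has_bochner_integral_iff inner_diff_right)
  then show ?thesis by (simp add: H_def)
qed

lemma gaussian_noise_orthogonal:
  assumes t: "1 \<le> t"
  shows "has_bochner_integral M (\<lambda>\<omega>. J \<omega> * (gradf (x t \<omega>) \<bullet> \<zeta> t \<omega>)) 0"
proof -
  define H where "H \<omega> = J \<omega> *\<^sub>R gradf (x t \<omega>)" for \<omega>
  have H: "square_integrable M H" "H \<in> borel_measurable (F t)"
    using square_integrable_J_gradf[OF t] gradf_F_measurable[OF t] by (simp_all add: H_def[abs_def])
  \<comment> \<open>In each coordinate the past-measurable factor is independent of the centred
    noise, so every summand has mean zero.\<close>
  have "has_bochner_integral M (\<lambda>\<omega>. \<Sum>b\<in>Basis. (H \<omega> \<bullet> b) * (\<zeta> t \<omega> \<bullet> b)) (\<Sum>b\<in>(Basis::'a set). 0)"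
  proof (rule has_bochner_integral_sum)
    fix b :: 'a assume b: "b \<in> Basis"
    \<comment> \<open>Pairing with a constant vector, which is square integrable on a probability
      space, turns square integrability into integrability.\<close>
    have "integrable M (\<lambda>\<omega>. H \<omega> \<bullet> b)"
      by (rule integrable_square_integrable_inner[OF H(1) square_integrable_const])
    moreover have "has_bochner_integral M (\<lambda>\<omega>. \<zeta> t \<omega> \<bullet> b) 0"
      by (rule isotropic_gaussian_coord_moments(1)[OF \<zeta>_measurable[OF t] \<zeta>_gaussian[OF t] b])
    ultimately show "has_bochner_integral M (\<lambda>\<omega>. (H \<omega> \<bullet> b) * (\<zeta> t \<omega> \<bullet> b)) 0"
      using indep_of_past_and_expectation_mult[OF \<zeta>_indep[OF t] F_subalgebra \<zeta>_measurable[OF t], of "\<lambda>u. u \<bullet> b" "\<lambda>\<omega>. H \<omega> \<bullet> b"] H(2)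
      by (simp add: has_bochner_integral_iff)
  qed
  then have "has_bochner_integral M (\<lambda>\<omega>. H \<omega> \<bullet> \<zeta> t \<omega>) 0"
    by (subst euclidean_inner) simp
  then show ?thesis by (simp add: H_def)
qed

lemma integrable_J_gap:
  assumes t: "1 \<le> t"
  shows "integrable M (\<lambda>\<omega>. J \<omega> * (f (z t \<omega>) - fstar))"
proof (rule Bochner_Integration.integrable_bound)
  \<comment> \<open>The descent lemma from the origin gives quadratic growth of \<open>f\<close>.
    Young's inequality on \<open>gradf 0 \<bullet> w\<close> produces the last summand of
    \<open>c\<close> and the 1 in \<open>1 + L\<close>.\<close>
  define c where "c = \<bar>f 0\<bar> + \<bar>fstar\<bar> + (norm (gradf 0))\<^sup>2"
  have "(\<lambda>\<omega>. J \<omega> *\<^sub>R z t \<omega>) = (\<lambda>\<omega>. J \<omega> *\<^sub>R x t \<omega> + (\<beta> / (1 - \<beta>)) *\<^sub>R (J \<omega> *\<^sub>R v t \<omega>))"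
    using z_def[OF t] by (auto simp: scaleR_add_right ac_simps)
  then have "square_integrable M (\<lambda>\<omega>. J \<omega> *\<^sub>R z t \<omega>)"
    using square_integrable_J_xy[OF t] square_integrable_J_v[OF t]
    by (auto intro!: square_integrable_add square_integrable_scaleR simp del: scaleR_scaleR)
  from integrable_J_norm2[OF this]
  show "integrable M (\<lambda>\<omega>. c + (1 + L) * (J \<omega> * (norm (z t \<omega>))\<^sup>2))" by simp
  note [measurable] = z_measurable[OF t]
  show "(\<lambda>\<omega>. J \<omega> * (f (z t \<omega>) - fstar)) \<in> borel_measurable M" by measurable
  show "AE \<omega> in M. norm (J \<omega> * (f (z t \<omega>) - fstar)) \<le> norm (c + (1 + L) * (J \<omega> * (norm (z t \<omega>))\<^sup>2))"
  proof (rule AE_I2)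
    fix \<omega>
    define w where "w = z t \<omega>"
    have "f w \<le> f 0 + gradf 0 \<bullet> w + L / 2 * (norm w)\<^sup>2"
      using descent_lemma[OF grad lipschitz, of w 0] by simp
    moreover have "gradf 0 \<bullet> w \<le> (norm (gradf 0))\<^sup>2 + (norm w)\<^sup>2"
      using norm_cauchy_schwarz[of "gradf 0" w] sum_squares_bound[of "norm (gradf 0)" "norm w"]
        mult_nonneg_nonneg[OF norm_ge_zero norm_ge_zero, of "gradf 0" w] by linarith
    moreover have "L / 2 * (norm w)\<^sup>2 \<le> L * (norm w)\<^sup>2" "0 \<le> L * (norm w)\<^sup>2" using L_nonneg by auto
    ultimately have "f w - fstar \<le> c + (1 + L) * (norm w)\<^sup>2"
      by (simp add: c_def distrib_right)
    moreover have "0 \<le> f w - fstar" using fstar_lower by simp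
    moreover have "0 \<le> c" by (simp add: c_def)
    ultimately show "norm (J \<omega> * (f (z t \<omega>) - fstar)) \<le> norm (c + (1 + L) * (J \<omega> * (norm (z t \<omega>))\<^sup>2))"
      using J_cases[of \<omega>] by (auto simp: w_def)
  qed
qed

section \<open>Summability in expectation\<close>

lemma summable_expected_momentum:
  "summable (\<lambda>t. \<integral>\<omega>. J \<omega> * (norm (v (Suc t) \<omega>))\<^sup>2 \<partial>M)"
proof (rule summable_contraction[OF _ \<beta>(2)])
  show "summable (\<lambda>t. \<kappa> * ((\<alpha> (Suc t))\<^sup>2 * B))"
    by (intro summable_mult summable_mult2 step_square_summable_Suc)
  have "0 \<le> B" by (simp add: B_def)
  then show "0 \<le> \<kappa> * ((\<alpha> (Suc t))\<^sup>2 * B)" for t using \<beta> by simp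
  show "0 \<le> (\<integral>\<omega>. J \<omega> * (norm (v (Suc t) \<omega>))\<^sup>2 \<partial>M)" for t
    using J_nonneg by simp
  fix t
  have v: "integrable M (\<lambda>\<omega>. J \<omega> * (norm (v (Suc s) \<omega>))\<^sup>2)" for s
    by (intro integrable_J_norm2 square_integrable_J_v) simp
  have g: "integrable M (\<lambda>\<omega>. (norm (gCN (Suc t) \<omega>))\<^sup>2)" "(\<integral>\<omega>. (norm (gCN (Suc t) \<omega>))\<^sup>2 \<partial>M) \<le> B"
    using gCN_second_moment[of "Suc t"] by (auto simp: square_integrable_def)
  \<comment> \<open>The weight \<open>J\<close> stays on the momentum, whose second moment may be
    infinite without it, and is dropped from the gradient term, which is integrable
    outright.\<close>
  have "(\<integral>\<omega>. J \<omega> * (norm (v (Suc (Suc t)) \<omega>))\<^sup>2 \<partial>M) \<le>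
      (\<integral>\<omega>. \<beta> * (J \<omega> * (norm (v (Suc t) \<omega>))\<^sup>2) + \<kappa> * ((\<alpha> (Suc t))\<^sup>2 * (norm (gCN (Suc t) \<omega>))\<^sup>2) \<partial>M)"
  proof (rule integral_mono[OF v])
    fix \<omega>
    have "(norm (v (Suc (Suc t)) \<omega>))\<^sup>2 \<le> \<beta> * (norm (v (Suc t) \<omega>))\<^sup>2 + \<kappa> * ((\<alpha> (Suc t))\<^sup>2 * (norm (gCN (Suc t) \<omega>))\<^sup>2)"
      using norm_square_contraction[OF \<beta>, of "\<alpha> (Suc t)" "v (Suc t) \<omega>" "gCN (Suc t) \<omega>"] step_pos[of "Suc t"]
      by (simp add: v_step less_imp_le)
    then show "J \<omega> * (norm (v (Suc (Suc t)) \<omega>))\<^sup>2 \<le>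
        \<beta> * (J \<omega> * (norm (v (Suc t) \<omega>))\<^sup>2) + \<kappa> * ((\<alpha> (Suc t))\<^sup>2 * (norm (gCN (Suc t) \<omega>))\<^sup>2)"
      using J_cases[of \<omega>] \<beta> by auto
  qed (use v g in auto)
  also have "\<dots> = \<beta> * (\<integral>\<omega>. J \<omega> * (norm (v (Suc t) \<omega>))\<^sup>2 \<partial>M) +
      \<kappa> * ((\<alpha> (Suc t))\<^sup>2 * (\<integral>\<omega>. (norm (gCN (Suc t) \<omega>))\<^sup>2 \<partial>M))"
    using v[of t] g(1) by (simp del: times_divide_eq_left)
  also have "\<dots> \<le> \<beta> * (\<integral>\<omega>. J \<omega> * (norm (v (Suc t) \<omega>))\<^sup>2 \<partial>M) + \<kappa> * ((\<alpha> (Suc t))\<^sup>2 * B)"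
    using g(2) \<beta> by (intro add_left_mono mult_left_mono) auto
  finally show "(\<integral>\<omega>. J \<omega> * (norm (v (Suc (Suc t)) \<omega>))\<^sup>2 \<partial>M) \<le>
      \<beta> * (\<integral>\<omega>. J \<omega> * (norm (v (Suc t) \<omega>))\<^sup>2 \<partial>M) + \<kappa> * ((\<alpha> (Suc t))\<^sup>2 * B)" .
qed

lemma integrable_J_Psi:
  assumes t: "1 \<le> t"
  shows "integrable M (\<lambda>\<omega>. J \<omega> * Psi q (norm (gradf (x t \<omega>))))"
proof (rule Bochner_Integration.integrable_bound[OF integrable_J_norm2[OF square_integrable_J_gradf[OF t]]])
  note [measurable] = x_measurable[OF t]
  show "(\<lambda>\<omega>. J \<omega> * Psi q (norm (gradf (x t \<omega>)))) \<in> borel_measurable M" by measurable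
  show "AE \<omega> in M. norm (J \<omega> * Psi q (norm (gradf (x t \<omega>)))) \<le> norm (J \<omega> * (norm (gradf (x t \<omega>)))\<^sup>2)"
    using J_nonneg q_pos by (intro AE_I2) (auto simp: abs_mult Psi_nonneg intro!: mult_left_mono, simp add: Psi_def)
qed

lemma expected_energy_step:
  assumes t: "1 \<le> t"
  shows "(\<integral>\<omega>. J \<omega> * (f (z (Suc t) \<omega>) - fstar) \<partial>M)
      + \<kappa> * ((q - \<sigma>g) / q) * (\<alpha> t * (\<integral>\<omega>. J \<omega> * Psi q (norm (gradf (x t \<omega>))) \<partial>M))
    \<le> (\<integral>\<omega>. J \<omega> * (f (z t \<omega>) - fstar) \<partial>M)
      + \<kappa>\<^sup>2 * L * ((\<integral>\<omega>. J \<omega> * (norm (v t \<omega>))\<^sup>2 \<partial>M) + (\<alpha> t)\<^sup>2 * B)"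
proof -
  have \<kappa>: "0 \<le> \<kappa>" and a: "0 < \<alpha> t" using \<beta> step_pos[OF t] by auto
  define \<Psi> where "\<Psi> \<omega> = J \<omega> * Psi q (norm (gradf (x t \<omega>)))" for \<omega>
  define gap where "gap s \<omega> = J \<omega> * (f (z s \<omega>) - fstar)" for s \<omega>
  define V where "V \<omega> = J \<omega> * (norm (v t \<omega>))\<^sup>2" for \<omega>
  define n where "n \<omega> = J \<omega> * (gradf (x t \<omega>) \<bullet> (stoch_grad t \<omega> - gradf (x t \<omega>)))" for \<omega>
  define w where "w \<omega> = J \<omega> * (gradf (x t \<omega>) \<bullet> \<zeta> t \<omega>)" for \<omega>
  define c where "c = (q - \<sigma>g) / q"
  have int: "integrable M \<Psi>" "integrable M (gap t)" "integrable M (gap (Suc t))" "integrable M V"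
    using integrable_J_Psi[OF t] integrable_J_gap[OF t] integrable_J_gap[of "Suc t"]
      integrable_J_norm2[OF square_integrable_J_v[OF t]]
    by (simp_all add: \<Psi>_def[abs_def] gap_def[abs_def] V_def[abs_def])
  have noise: "has_bochner_integral M n 0" "has_bochner_integral M w 0"
    using sampling_noise_orthogonal[OF t] gaussian_noise_orthogonal[OF t]
    by (simp_all add: n_def[abs_def] w_def[abs_def])
  have g: "integrable M (\<lambda>\<omega>. (norm (gCN t \<omega>))\<^sup>2)" "(\<integral>\<omega>. (norm (gCN t \<omega>))\<^sup>2 \<partial>M) \<le> B"
    using gCN_second_moment[OF t] by (auto simp: square_integrable_def)
  \<comment> \<open>The noise terms \<open>n\<close> and \<open>w\<close> are carried along exactly
    instead of being estimated: their integrals are zero, so they disappear once expectations are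
    taken.\<close>
  have "AE \<omega> in M. gap (Suc t) \<omega> + \<kappa> * \<alpha> t * (c * \<Psi> \<omega> + n \<omega> + q * w \<omega>) \<le>
      gap t \<omega> + \<kappa>\<^sup>2 * L * (V \<omega> + (\<alpha> t)\<^sup>2 * (norm (gCN t \<omega>))\<^sup>2)"
    using bounded_noise_iterates[OF t]
  proof eventually_elim
    case (elim \<omega>)
    show ?case
    proof (cases "J \<omega> = 0")
      case True
      then show ?thesis
        using L_nonneg by (simp add: gap_def \<Psi>_def n_def w_def V_def)
    next
      case False
      then have J: "J \<omega> = 1" using J_cases[of \<omega>] by simp
      \<comment> \<open>The factor \<open>\<beta> / (1 - \<beta>)\<close> is relaxed to
        \<open>\<kappa>\<close>, so that distance and step length in \<open>energy_step\<close>
        share one constant.\<close>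
      have "norm (z t \<omega> - x t \<omega>) \<le> \<kappa> * norm (v t \<omega>)"
        using \<beta> z_def[OF t, of \<omega>] by (auto intro!: mult_right_mono divide_right_mono simp: mult_left_le_one_le)
      from energy_step[OF grad lipschitz L_nonneg \<kappa> less_imp_le[OF a] this, of "gCN t \<omega>"]
      have "f (z (Suc t) \<omega>) + \<kappa> * \<alpha> t * (gradf (x t \<omega>) \<bullet> gCN t \<omega>) \<le>
          f (z t \<omega>) + \<kappa>\<^sup>2 * L * ((norm (v t \<omega>))\<^sup>2 + (\<alpha> t)\<^sup>2 * (norm (gCN t \<omega>))\<^sup>2)"
        unfolding z_step[OF t] by linarith
      moreover have "\<kappa> * \<alpha> t * (c * \<Psi> \<omega> + n \<omega> + q * w \<omega>) \<le> \<kappa> * \<alpha> t * (gradf (x t \<omega>) \<bullet> gCN t \<omega>)"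
        using inner_clip_ge[OF elim \<sigma>g_less q_pos] \<kappa> a
        by (intro mult_left_mono) (auto simp: J \<Psi>_def n_def w_def c_def gCN_def[OF t] inner_add_right)
      ultimately show ?thesis by (simp add: J gap_def V_def)
    qed
  qed
  then have "(\<integral>\<omega>. gap (Suc t) \<omega> + \<kappa> * \<alpha> t * (c * \<Psi> \<omega> + n \<omega> + q * w \<omega>) \<partial>M) \<le>
      (\<integral>\<omega>. gap t \<omega> + \<kappa>\<^sup>2 * L * (V \<omega> + (\<alpha> t)\<^sup>2 * (norm (gCN t \<omega>))\<^sup>2) \<partial>M)"
    using int noise g by (intro integral_mono_AE) (auto simp: has_bochner_integral_iff)
  moreover have "(\<integral>\<omega>. gap (Suc t) \<omega> + \<kappa> * \<alpha> t * (c * \<Psi> \<omega> + n \<omega> + q * w \<omega>) \<partial>M) =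
      integral\<^sup>L M (gap (Suc t)) + \<kappa> * \<alpha> t * (c * integral\<^sup>L M \<Psi>)"
    using int noise by (simp add: has_bochner_integral_iff)
  moreover have "(\<integral>\<omega>. gap t \<omega> + \<kappa>\<^sup>2 * L * (V \<omega> + (\<alpha> t)\<^sup>2 * (norm (gCN t \<omega>))\<^sup>2) \<partial>M) =
      integral\<^sup>L M (gap t) + \<kappa>\<^sup>2 * L * (integral\<^sup>L M V + (\<alpha> t)\<^sup>2 * (\<integral>\<omega>. (norm (gCN t \<omega>))\<^sup>2 \<partial>M))"
    using int g by simp
  moreover have "\<kappa>\<^sup>2 * L * (integral\<^sup>L M V + (\<alpha> t)\<^sup>2 * (\<integral>\<omega>. (norm (gCN t \<omega>))\<^sup>2 \<partial>M)) \<le>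
      \<kappa>\<^sup>2 * L * (integral\<^sup>L M V + (\<alpha> t)\<^sup>2 * B)"
    using g(2) L_nonneg by (intro mult_left_mono add_left_mono) auto
  ultimately have "integral\<^sup>L M (gap (Suc t)) + \<kappa> * \<alpha> t * (c * integral\<^sup>L M \<Psi>) \<le>
      integral\<^sup>L M (gap t) + \<kappa>\<^sup>2 * L * (integral\<^sup>L M V + (\<alpha> t)\<^sup>2 * B)" by linarith
  then show ?thesis
    unfolding \<Psi>_def[abs_def] gap_def[abs_def] V_def[abs_def] c_def by (simp only: ac_simps)
qed

section \<open>From expectations to almost every path\<close>

lemma AE_summable_localized:
  shows "AE \<omega> in M. summable (\<lambda>t. J \<omega> * (norm (v (Suc t) \<omega>))\<^sup>2)"
    and "AE \<omega> in M. summable (\<lambda>t. \<alpha> (Suc t) * (J \<omega> * Psi q (norm (gradf (x (Suc t) \<omega>)))))"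
proof -
  show "AE \<omega> in M. summable (\<lambda>t. J \<omega> * (norm (v (Suc t) \<omega>))\<^sup>2)"
    using summable_expected_momentum J_nonneg
    by (intro AE_summable_of_summable_integral integrable_J_norm2 square_integrable_J_v) auto
  \<comment> \<open>The margin \<open>q - \<sigma>g\<close> left by the clipping level makes
    \<open>C\<close> positive, which allows dividing it out of the telescoped sum.\<close>
  define C where "C = \<kappa> * ((q - \<sigma>g) / q)"
  have C: "0 < C" using \<beta> \<sigma>g_less q_pos by (simp add: C_def)
  have \<Psi>: "0 \<le> J \<omega> * Psi q (norm (gradf (x t \<omega>)))" for t \<omega>
    using J_nonneg q_pos by (simp add: Psi_nonneg)
  have "summable (\<lambda>t. C * (\<alpha> (Suc t) * (\<integral>\<omega>. J \<omega> * Psi q (norm (gradf (x (Suc t) \<omega>))) \<partial>M)))"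
  proof (rule summable_decrease)
    show "(\<integral>\<omega>. J \<omega> * (f (z (Suc (Suc t)) \<omega>) - fstar) \<partial>M)
        + C * (\<alpha> (Suc t) * (\<integral>\<omega>. J \<omega> * Psi q (norm (gradf (x (Suc t) \<omega>))) \<partial>M))
      \<le> (\<integral>\<omega>. J \<omega> * (f (z (Suc t) \<omega>) - fstar) \<partial>M)
        + \<kappa>\<^sup>2 * L * ((\<integral>\<omega>. J \<omega> * (norm (v (Suc t) \<omega>))\<^sup>2 \<partial>M) + (\<alpha> (Suc t))\<^sup>2 * B)" for t
      using expected_energy_step[of "Suc t"] unfolding C_def by simp
    show "0 \<le> (\<integral>\<omega>. J \<omega> * (f (z (Suc t) \<omega>) - fstar) \<partial>M)" for t
      using J_nonneg fstar_lower by simp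
    show "0 \<le> C * (\<alpha> (Suc t) * (\<integral>\<omega>. J \<omega> * Psi q (norm (gradf (x (Suc t) \<omega>))) \<partial>M))" for t
      using C step_pos[of "Suc t"] \<Psi> by simp
    show "0 \<le> \<kappa>\<^sup>2 * L * ((\<integral>\<omega>. J \<omega> * (norm (v (Suc t) \<omega>))\<^sup>2 \<partial>M) + (\<alpha> (Suc t))\<^sup>2 * B)" for t
      using L_nonneg J_nonneg by (simp add: B_def)
    show "summable (\<lambda>t. \<kappa>\<^sup>2 * L * ((\<integral>\<omega>. J \<omega> * (norm (v (Suc t) \<omega>))\<^sup>2 \<partial>M) + (\<alpha> (Suc t))\<^sup>2 * B))"
      by (intro summable_mult summable_add summable_expected_momentum summable_mult2 step_square_summable_Suc)
  qed
  then have "summable (\<lambda>t. \<alpha> (Suc t) * (\<integral>\<omega>. J \<omega> * Psi q (norm (gradf (x (Suc t) \<omega>))) \<partial>M))"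
    using C by (simp add: summable_cmult_iff)
  then show "AE \<omega> in M. summable (\<lambda>t. \<alpha> (Suc t) * (J \<omega> * Psi q (norm (gradf (x (Suc t) \<omega>)))))"
    using \<Psi> step_pos integrable_J_Psi
    by (intro AE_summable_of_summable_integral) (auto simp: less_imp_le)
qed

end

text \<open>Only countably many levels \<open>N = real n\<close> are used, so their exceptional null
  sets can be united; for each path some level exceeds both initial norms, and there
  \<open>J\<close> is 1.\<close>

lemma AE_summable_paths:
  shows "AE \<omega> in M. summable (\<lambda>t. (norm (v (Suc t) \<omega>))\<^sup>2)"
    and "AE \<omega> in M. summable (\<lambda>t. \<alpha> (Suc t) * Psi q (norm (gradf (x (Suc t) \<omega>))))"
proof -
  have exhaust: "\<exists>n. J (real n) \<omega> = 1" if "\<omega> \<in> space M" for \<omega>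
  proof -
    obtain n where "max (norm (y 0 \<omega>)) (norm (y 1 \<omega>)) \<le> real n" using real_arch_simple by blast
    then show ?thesis using that by (auto simp: J_def intro!: exI[of _ n])
  qed
  have "AE \<omega> in M. \<forall>n. summable (\<lambda>t. J (real n) \<omega> * (norm (v (Suc t) \<omega>))\<^sup>2)"
    unfolding AE_all_countable using AE_summable_localized(1) by blast
  with AE_space show "AE \<omega> in M. summable (\<lambda>t. (norm (v (Suc t) \<omega>))\<^sup>2)"
  proof eventually_elim
    case (elim \<omega>)
    obtain n where n: "J (real n) \<omega> = 1" using exhaust[OF elim(1)] by blast
    show ?case using elim(2)[rule_format, of n] unfolding n by simp
  qed
  have "AE \<omega> in M. \<forall>n. summable (\<lambda>t. \<alpha> (Suc t) * (J (real n) \<omega> * Psi q (norm (gradf (x (Suc t) \<omega>)))))"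
    unfolding AE_all_countable using AE_summable_localized(2) by blast
  with AE_space show "AE \<omega> in M. summable (\<lambda>t. \<alpha> (Suc t) * Psi q (norm (gradf (x (Suc t) \<omega>))))"
  proof eventually_elim
    case (elim \<omega>)
    obtain n where n: "J (real n) \<omega> = 1" using exhaust[OF elim(1)] by blast
    show ?case using elim(2)[rule_format, of n] unfolding n by simp
  qed
qed

end

section \<open>Almost sure limits and rates\<close>

theorem theorem3:
  fixes f :: "'a::euclidean_space \<Rightarrow> real" and gradf :: "'a \<Rightarrow> 'a"
    and fstar L \<sigma>g q \<beta> \<theta> \<sigma>CN :: real
    and \<alpha> :: "nat \<Rightarrow> real"
    and M :: "'w measure" and S :: "'s measure" and I :: "'i measure"
    and G :: "'a \<Rightarrow> 's \<Rightarrow> 'a"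
    and ini :: "'w \<Rightarrow> 'i" and \<xi> :: "nat \<Rightarrow> 'w \<Rightarrow> 's"
    and \<zeta> x y v z gCN :: "nat \<Rightarrow> 'w \<Rightarrow> 'a"
    and F :: "nat \<Rightarrow> 'w measure"
  assumes grad: "\<And>u. GDERIV f u :> gradf u"
    and lipschitz: "\<And>u w. norm (gradf u - gradf w) \<le> L * norm (u - w)"
    and fstar_lower: "\<And>u. fstar \<le> f u"
    and fstar_attained: "\<exists>u. f u = fstar"
    and params: "0 \<le> \<sigma>g" "\<sigma>g < q" "0 < q" "0 \<le> \<beta>" "\<beta> < 1" "0 < \<theta>" "\<theta> < 1/2" "0 \<le> \<sigma>CN"
    and step_pos: "\<And>t. 1 \<le> t \<Longrightarrow> 0 < \<alpha> t"
    and step_noninc: "\<And>t. 1 \<le> t \<Longrightarrow> \<alpha> (Suc t) \<le> \<alpha> t"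
    and step_order: "\<alpha> \<in> \<Theta>(\<lambda>t. real t powr (- (1 - \<theta>)))"
    and prob: "prob_space M"
    and G_measurable: "(\<lambda>(u, s). G u s) \<in> borel_measurable (borel \<Otimes>\<^sub>M S)"
    and ini_measurable: "ini \<in> measurable M I"
    and \<xi>_measurable: "\<And>t. 1 \<le> t \<Longrightarrow> \<xi> t \<in> measurable M S"
    and \<zeta>_measurable: "\<And>t. 1 \<le> t \<Longrightarrow> \<zeta> t \<in> borel_measurable M"
    and F_def: "\<And>t. F t = natural_filtration M ini I \<xi> S \<zeta> t"
    and \<zeta>_gaussian: "\<And>t. 1 \<le> t \<Longrightarrow> distr M borel (\<zeta> t) = isotropic_gaussian \<sigma>CN"
    and \<zeta>_indep: "\<And>t. 1 \<le> t \<Longrightarrow> indep_of_past_and M (F t) (\<xi> t) S (\<zeta> t)"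
    and y0_measurable: "y 0 \<in> borel_measurable (F 1)"
    and y1_measurable: "y 1 \<in> borel_measurable (F 1)"
    and x1: "\<And>\<omega>. x 1 \<omega> = y 1 \<omega> + \<beta> *\<^sub>R (y 1 \<omega> - y 0 \<omega>)"
    and gCN_def: "\<And>t \<omega>. 1 \<le> t \<Longrightarrow> gCN t \<omega> = clip q (G (x t \<omega>) (\<xi> t \<omega>)) + q *\<^sub>R \<zeta> t \<omega>"
    and y_step: "\<And>t \<omega>. 1 \<le> t \<Longrightarrow> y (t + 1) \<omega> = x t \<omega> - \<alpha> t *\<^sub>R gCN t \<omega>"
    and x_step: "\<And>t \<omega>. 1 \<le> t \<Longrightarrow> x (t + 1) \<omega> = y (t + 1) \<omega> + \<beta> *\<^sub>R (y (t + 1) \<omega> - y t \<omega>)"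
    and v_def: "\<And>t \<omega>. 1 \<le> t \<Longrightarrow> v t \<omega> = \<beta> *\<^sub>R (y t \<omega> - y (t - 1) \<omega>)"
    and z_def: "\<And>t \<omega>. 1 \<le> t \<Longrightarrow> z t \<omega> = x t \<omega> + (\<beta> / (1 - \<beta>)) *\<^sub>R v t \<omega>"
    and unbiased: "\<And>t. 1 \<le> t \<Longrightarrow>
      AE \<omega> in M. vec_cond_exp M (F t) (\<lambda>\<omega>. G (x t \<omega>) (\<xi> t \<omega>)) \<omega> = gradf (x t \<omega>)"
    and bounded_noise: "\<And>t u. 1 \<le> t \<Longrightarrow> AE \<omega> in M. norm (G u (\<xi> t \<omega>) - gradf u) \<le> \<sigma>g"
    and bounded_noise_iterates:
      "\<And>t. 1 \<le> t \<Longrightarrow> AE \<omega> in M. norm (G (x t \<omega>) (\<xi> t \<omega>) - gradf (x t \<omega>)) \<le> \<sigma>g"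
  shows "(AE \<omega> in M. summable (\<lambda>t. \<alpha> (Suc t) * Psi q (norm (gradf (x (Suc t) \<omega>)))))
    \<and> (AE \<omega> in M. summable (\<lambda>t. (norm (v (Suc t) \<omega>))\<^sup>2))
    \<and> (AE \<omega> in M. (\<lambda>t. norm (v t \<omega>)) \<longlonglongrightarrow> 0)
    \<and> (AE \<omega> in M. (\<lambda>t. norm (z t \<omega> - x t \<omega>)) \<longlonglongrightarrow> 0)
    \<and> (AE \<omega> in M. (\<lambda>t. Min ((\<lambda>i. Psi q (norm (gradf (x i \<omega>)))) ` {1..t}))
          \<in> o(\<lambda>t. real t powr (- \<theta>)))
    \<and> (AE \<omega> in M. (\<lambda>t. Min ((\<lambda>i. norm (gradf (x i \<omega>))) ` {1..t}))
          \<in> o(\<lambda>t. real t powr (- (\<theta> / 2))))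
    \<and> (\<forall>\<mu>>0. strongly_convex \<mu> f gradf \<longrightarrow>
          (AE \<omega> in M. (\<lambda>t. Min ((\<lambda>i. f (x i \<omega>) - fstar) ` {1..t}))
            \<in> o(\<lambda>t. real t powr (- \<theta>))))"
proof -
  have "- (1 - \<theta>) < - 1 / 2" using params by simp
  with step_order have \<alpha>2: "summable (\<lambda>t. (\<alpha> t)\<^sup>2)"
    by (intro powr_order_square_summable[of _ "- (1 - \<theta>)"]) auto
  interpret prob_space M by (fact prob)
  interpret snag_cn M f gradf fstar L \<sigma>g q \<beta> \<sigma>CN \<alpha> S I G ini \<xi> \<zeta> x y v z gCN F
    by unfold_locales (fact assms params \<alpha>2)+
  note momentum = AE_summable_paths(1) and gradients = AE_summable_paths(2)
  have v_lim: "AE \<omega> in M. (\<lambda>t. norm (v t \<omega>)) \<longlonglongrightarrow> 0"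
    using momentum
  proof eventually_elim
    case (elim \<omega>)
    \<comment> \<open>The series starts with \<open>v 1\<close>, so the limit is obtained for the
      shifted sequence and then shifted back.\<close>
    from tendsto_real_sqrt[OF summable_LIMSEQ_zero[OF elim]] show ?case
      using LIMSEQ_imp_Suc[of "\<lambda>t. norm (v t \<omega>)" 0] by simp
  qed
  have "AE \<omega> in M. (\<lambda>t. norm (z t \<omega> - x t \<omega>)) \<longlonglongrightarrow> 0"
    using v_lim
  proof eventually_elim
    case (elim \<omega>)
    have "(\<lambda>t. \<beta> / (1 - \<beta>) * norm (v t \<omega>)) \<longlonglongrightarrow> 0"
      using tendsto_mult_left[OF elim, of "\<beta> / (1 - \<beta>)"] by simp
    moreover have "eventually (\<lambda>t. \<beta> / (1 - \<beta>) * norm (v t \<omega>) = norm (z t \<omega> - x t \<omega>)) sequentially"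
      using eventually_ge_at_top[of 1] by eventually_elim (use params in \<open>simp add: z_def\<close>)
    ultimately show ?case by (rule Lim_transform_eventually)
  qed
  moreover note rates = running_min_rates[OF step_pos step_noninc step_order params(3) params(6) norm_ge_zero]
  have "AE \<omega> in M. (\<lambda>t. Min ((\<lambda>i. Psi q (norm (gradf (x i \<omega>)))) ` {1..t})) \<in> o(\<lambda>t. real t powr (- \<theta>))"
    using gradients by eventually_elim (rule rates(1))
  moreover have norm_rate:
    "AE \<omega> in M. (\<lambda>t. Min ((\<lambda>i. norm (gradf (x i \<omega>))) ` {1..t})) \<in> o(\<lambda>t. real t powr (- (\<theta> / 2)))"
    using gradients by eventually_elim (rule rates(2))
  moreover have "AE \<omega> in M. (\<lambda>t. Min ((\<lambda>i. f (x i \<omega>) - fstar) ` {1..t})) \<in> o(\<lambda>t. real t powr (- \<theta>))"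
    if \<mu>: "0 < \<mu>" and sc: "strongly_convex \<mu> f gradf" for \<mu>
    using norm_rate
  proof eventually_elim
    case (elim \<omega>)
    \<comment> \<open>The gap bound compares with an arbitrary point; a minimiser turns it into a
      bound on the distance to \<open>fstar\<close>, with
      \<open>K = 1 / (2 * \<mu>)\<close>.\<close>
    obtain u where u: "f u = fstar" using fstar_attained by blast
    show ?case
    proof (rule running_min_quadratic[OF elim])
      show "0 \<le> f (x t \<omega>) - fstar" for t using fstar_lower by simp
      show "f (x t \<omega>) - fstar \<le> 1 / (2 * \<mu>) * (norm (gradf (x t \<omega>)))\<^sup>2" for t
        using strongly_convex_gap_le[OF sc \<mu>, of "x t \<omega>" u] by (simp add: u)
    qed
  qed
  ultimately show ?thesis using momentum gradients v_lim by blast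
qed

end
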